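(* Let $X$ be a centered Gaussian (column) vector in $\mathbb{R}^r$ with positive definite covariance matrix $P$, and let $\mathcal{X}=XX'$. For any $n\ge 0$, $$\mathbb{E}\big[(\mathcal{X}-P)^n\big]=(-1)^nP^n+\sum_{0\le k<n}(-1)^k\,W(n-k,k).$$ In addition, for any $n\geq 0$, in the Loewner order, $$\mathbb{E}\big[(\mathcal{X}-P)^{2n}\big]\ \le\ \mathbb{E}\big[\mathcal{X}^{2n}\big]-(2n-1)P^{2n}-\frac14\sum_{1\le k<n}W(2(n-k)+1,\,2k-1),$$ $$\mathbb{E}\big[(\mathcal{X}-P)^{2n+1}\big]\ \le\ \mathbb{E}\big[\mathcal{X}^{2n+1}\big]-P^{2n+1}-\frac14\sum_{1\le k\le n}W(2(n+1-k),\,2k-1).$$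
   Context: $\mathbb{N}=\{0,1,2,\dots\}$, $A'$ denotes transpose. For symmetric matrices, $S_1\le S_2$ (Loewner order) means $S_2-S_1$ is positive semidefinite. For $v=(v_1,\dots,v_m)\in\mathbb{N}^m$, $$M(v)=\mathbb{E}\big[(\mathcal{X}P^{v_1})(\mathcal{X}P^{v_2})\cdots(\mathcal{X}P^{v_m})\big],$$ and for $m\ge1$, $n\ge0$, $$W(m,n)=\sum_{v\in\mathbb{N}^m,\ v_1+\dots+v_m=n}(1+v_m)\,M(v).$$ Empty sums are zero. *)

theory Defs
  imports "HOL-Probability.Probability"
begin

(* The library's power operator on vectors and matrices is componentwise. *)
primrec mpow :: "real^'n^'n \<Rightarrow> nat \<Rightarrow> real^'n^'n" where
  "mpow A 0 = mat 1"
| "mpow A (Suc k) = A ** mpow A k"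

definition mprod :: "(real^'n^'n) list \<Rightarrow> real^'n^'n" where
  "mprod As = foldr (**) As (mat 1)"

definition outer :: "real^'n \<Rightarrow> real^'n^'n" where
  "outer x = (columnvector x :: real^1^'n) ** (rowvector x :: real^'n^1)"

definition symmetric_mat :: "real^'n^'n \<Rightarrow> bool" where
  "symmetric_mat A \<longleftrightarrow> transpose A = A"

definition pos_semidef :: "real^'n^'n \<Rightarrow> bool" where
  "pos_semidef A \<longleftrightarrow> symmetric_mat A \<and> (\<forall>x. 0 \<le> x \<bullet> (A *v x))"

definition pos_def :: "real^'n^'n \<Rightarrow> bool" where
  "pos_def A \<longleftrightarrow> symmetric_mat A \<and> (\<forall>x. x \<noteq> 0 \<longrightarrow> 0 < x \<bullet> (A *v x))"

definition loewner_le :: "real^'n^'n \<Rightarrow> real^'n^'n \<Rightarrow> bool"  (infix "\<preceq>\<^sub>L" 50) where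
  "S \<preceq>\<^sub>L T \<longleftrightarrow> symmetric_mat S \<and> symmetric_mat T \<and> pos_semidef (T - S)"

(* Every linear functional is univariate normal; point masses (zero variance) count as normal. *)
definition gaussian_vector :: "'a measure \<Rightarrow> ('a \<Rightarrow> real^'n) \<Rightarrow> bool" where
  "gaussian_vector \<Omega> X \<longleftrightarrow> X \<in> borel_measurable \<Omega> \<and>
     (\<forall>u. (\<exists>\<mu> \<sigma>. 0 < \<sigma> \<and> distributed \<Omega> lborel (\<lambda>\<omega>. u \<bullet> X \<omega>) (normal_density \<mu> \<sigma>)) \<or>
          (\<exists>c. AE \<omega> in \<Omega>. u \<bullet> X \<omega> = c))"

definition covariance_mat :: "'a measure \<Rightarrow> ('a \<Rightarrow> real^'n) \<Rightarrow> real^'n^'n" where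
  "covariance_mat \<Omega> X =
     (\<chi> i j. \<integral>\<omega>. (X \<omega> $ i - (\<integral>\<omega>'. X \<omega>' $ i \<partial>\<Omega>)) * (X \<omega> $ j - (\<integral>\<omega>'. X \<omega>' $ j \<partial>\<Omega>)) \<partial>\<Omega>)"

definition centered_gaussian :: "'a measure \<Rightarrow> ('a \<Rightarrow> real^'n) \<Rightarrow> real^'n^'n \<Rightarrow> bool" where
  "centered_gaussian \<Omega> X P \<longleftrightarrow>
     gaussian_vector \<Omega> X \<and> (\<integral>\<omega>. X \<omega> \<partial>\<Omega>) = 0 \<and> covariance_mat \<Omega> X = P"

definition word_moment :: "'a measure \<Rightarrow> ('a \<Rightarrow> real^'n) \<Rightarrow> real^'n^'n \<Rightarrow> nat list \<Rightarrow> real^'n^'n" where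
  "word_moment \<Omega> X P v = (\<integral>\<omega>. mprod (map (\<lambda>k. outer (X \<omega>) ** mpow P k) v) \<partial>\<Omega>)"

(* Meaningful for m \<ge> 1, where last v is the m-th entry of v. *)
definition W_sum :: "'a measure \<Rightarrow> ('a \<Rightarrow> real^'n) \<Rightarrow> real^'n^'n \<Rightarrow> nat \<Rightarrow> nat \<Rightarrow> real^'n^'n" where
  "W_sum \<Omega> X P m n =
     (\<Sum>v | length v = m \<and> sum_list v = n. (1 + real (last v)) *\<^sub>R word_moment \<Omega> X P v)"

end

theory Submission
  imports Defs
begin

text \<open>
  Write \<open>Y = X X'\<close> and \<open>q(a) = X \<bullet> P^a X\<close>. A word \<open>(YP^v\<^sub>1)\<dots>(YP^v\<^sub>m)\<close> equals \<open>q(v\<^sub>1) \<dots> q(v\<^sub>m\<^sub>-\<^sub>1) Y P^v\<^sub>m\<close>,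
  so everything is governed by the matrices \<open>B(m, j) = E[h(m, j) Y]\<close>, where \<open>h(m, j)\<close> is the coefficient of \<open>s^j\<close> in \<open>(\<Sum>a. q(a) s^a)^m\<close>.
  Stein's identity \<open>E[(u \<bullet> X) f(X)] = E[P u \<bullet> \<nabla>f(X)]\<close> for polynomials, obtained from the moments of the linear
  functionals by polarisation, gives
  \<open>B(m+1, j) = \<Sum>a\<le>j. (tr P^(a+1) B(m, j-a) + P^(a+1) B(m, j-a) + B(m, j-a) P^(a+1)) + 2 (j+1) B(m, j+1)\<close>.
  Hence each \<open>B(m, j)\<close> is a combination of powers of \<open>P\<close> with nonnegative coefficients. It commutes with \<open>P\<close>,
  so in the expansion of \<open>(Y - P)^n\<close> the leading powers of \<open>P\<close> move to the end of each word, which is the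
  identity. Discarding nonnegative terms of the recursion gives \<open>2 W(m, n + 1) \<le> W(m + 1, n)\<close> for \<open>m, n \<ge> 1\<close>,
  and pairing consecutive terms of the alternating sum gives the inequalities.
\<close>

section \<open>Random variables with all moments\<close>

text \<open>Integrability alone is not preserved by products; this property is, so that
  integrability of polynomial expressions in the Gaussian vector follows by structural
  rules.\<close>

definition has_all_moments :: "'a measure \<Rightarrow> ('a \<Rightarrow> real) \<Rightarrow> bool" where
  "has_all_moments M f \<longleftrightarrow> f \<in> borel_measurable M \<and> (\<forall>k. integrable M (\<lambda>x. \<bar>f x\<bar> ^ k))"

lemma has_all_moments_integrable_power:
  assumes "has_all_moments M f"
  shows "integrable M (\<lambda>x. f x ^ k)"
proof (rule Bochner_Integration.integrable_bound)
  show "integrable M (\<lambda>x. \<bar>f x\<bar> ^ k)" and "(\<lambda>x. f x ^ k) \<in> borel_measurable M"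
    using assms by (auto simp: has_all_moments_def)
qed (simp add: power_abs)

lemma has_all_moments_integrable:
  "has_all_moments M f \<Longrightarrow> integrable M f"
  using has_all_moments_integrable_power[of M f 1] by simp

lemma (in finite_measure) has_all_moments_const:
  "has_all_moments M (\<lambda>_. c)"
  by (simp add: has_all_moments_def)

lemma has_all_moments_add:
  assumes f: "has_all_moments M f" and g: "has_all_moments M g"
  shows "has_all_moments M (\<lambda>x. f x + g x)"
  unfolding has_all_moments_def
proof (intro conjI allI)
  show m: "(\<lambda>x. f x + g x) \<in> borel_measurable M"
    using f g by (auto simp: has_all_moments_def)
  fix k
  have "\<bar>a + b\<bar> ^ k \<le> 2 ^ k * \<bar>a\<bar> ^ k + 2 ^ k * \<bar>b\<bar> ^ k" for a b :: real
  proof -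
    have "\<bar>a + b\<bar> ^ k \<le> (2 * max \<bar>a\<bar> \<bar>b\<bar>) ^ k"
      by (intro power_mono) auto
    also have "\<dots> = 2 ^ k * max \<bar>a\<bar> \<bar>b\<bar> ^ k"
      by (simp add: power_mult_distrib)
    also have "\<dots> \<le> 2 ^ k * \<bar>a\<bar> ^ k + 2 ^ k * \<bar>b\<bar> ^ k"
      by (cases "\<bar>a\<bar> \<le> \<bar>b\<bar>") (auto simp: max_def)
    finally show ?thesis .
  qed
  then have le: "norm (\<bar>f x + g x\<bar> ^ k) \<le> norm (2 ^ k * \<bar>f x\<bar> ^ k + 2 ^ k * \<bar>g x\<bar> ^ k)" for x
    by (simp add: abs_of_nonneg)
  have "integrable M (\<lambda>x. 2 ^ k * \<bar>f x\<bar> ^ k + 2 ^ k * \<bar>g x\<bar> ^ k)"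
    using f g by (intro Bochner_Integration.integrable_add integrable_mult_right) (auto simp: has_all_moments_def)
  then show "integrable M (\<lambda>x. \<bar>f x + g x\<bar> ^ k)"
    by (rule Bochner_Integration.integrable_bound) (use m le in \<open>auto intro: AE_I2\<close>)
qed

text \<open>By 2 x y \<le> x^2 + y^2, the absolute moment of order k of the product is dominated by
  the moments of order 2 k of the factors.\<close>

lemma has_all_moments_mult:
  assumes f: "has_all_moments M f" and g: "has_all_moments M g"
  shows "has_all_moments M (\<lambda>x. f x * g x)"
  unfolding has_all_moments_def
proof (intro conjI allI)
  show m: "(\<lambda>x. f x * g x) \<in> borel_measurable M"
    using f g by (auto simp: has_all_moments_def)
  fix k
  have "\<bar>a * b\<bar> ^ k \<le> \<bar>a\<bar> ^ (2 * k) + \<bar>b\<bar> ^ (2 * k)" for a b :: real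
  proof -
    have "\<bar>a\<bar> ^ k * \<bar>b\<bar> ^ k \<le> (\<bar>a\<bar> ^ k)\<^sup>2 + (\<bar>b\<bar> ^ k)\<^sup>2"
      using sum_squares_bound[of "\<bar>a\<bar> ^ k" "\<bar>b\<bar> ^ k"]
        mult_nonneg_nonneg[OF zero_le_power_abs[of a k] zero_le_power_abs[of b k]]
      by (simp only: mult.assoc)
    then show ?thesis
      by (simp add: abs_mult power_mult_distrib power_mult[symmetric] mult.commute)
  qed
  then have le: "norm (\<bar>f x * g x\<bar> ^ k) \<le> norm (\<bar>f x\<bar> ^ (2 * k) + \<bar>g x\<bar> ^ (2 * k))" for x
    by (simp add: abs_of_nonneg)
  have "integrable M (\<lambda>x. \<bar>f x\<bar> ^ (2 * k) + \<bar>g x\<bar> ^ (2 * k))"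
    using f g by (intro Bochner_Integration.integrable_add) (auto simp: has_all_moments_def)
  then show "integrable M (\<lambda>x. \<bar>f x * g x\<bar> ^ k)"
    by (rule Bochner_Integration.integrable_bound) (use m le in \<open>auto intro: AE_I2\<close>)
qed

lemma (in finite_measure) has_all_moments_sum:
  "(\<And>i. i \<in> I \<Longrightarrow> has_all_moments M (f i)) \<Longrightarrow> has_all_moments M (\<lambda>x. \<Sum>i\<in>I. f i x)"
  by (induction I rule: infinite_finite_induct)
    (auto intro: has_all_moments_add has_all_moments_const)

lemma (in finite_measure) has_all_moments_cmult:
  "has_all_moments M f \<Longrightarrow> has_all_moments M (\<lambda>x. c * f x)"
  by (intro has_all_moments_mult has_all_moments_const)

lemma (in finite_measure) has_all_moments_coeff_mult:
  assumes "\<And>j. has_all_moments M (\<lambda>x. coeff (c x) j)" and "\<And>j. has_all_moments M (\<lambda>x. coeff (d x) j)"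
  shows "has_all_moments M (\<lambda>x. coeff (c x * d x) j)"
  using assms by (auto simp: coeff_mult intro!: has_all_moments_sum has_all_moments_mult)

lemma (in finite_measure) has_all_moments_coeff_linear:
  assumes "has_all_moments M f" and "has_all_moments M g"
  shows "has_all_moments M (\<lambda>x. coeff [:f x, g x:] j)"
proof (cases j)
  case (Suc i)
  then show ?thesis using assms has_all_moments_const[of 0] by (cases i) auto
qed (use assms in auto)

lemma (in finite_measure) has_all_moments_coeff_power:
  assumes "\<And>j. has_all_moments M (\<lambda>x. coeff (c x) j)"
  shows "has_all_moments M (\<lambda>x. coeff (c x ^ n) j)"
proof (induction n arbitrary: j)
  case 0
  show ?case by (simp add: has_all_moments_const)
next
  case (Suc n)
  then show ?case using assms by (auto intro!: has_all_moments_coeff_mult)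
qed

text \<open>The degree bound is uniform in x, so the expectation passes through finitely many
  coefficients. Coefficients of q can then be compared by comparing values at all t, which replaces
  differentiation under the integral.\<close>

lemma integral_poly:
  assumes "\<And>j. has_all_moments M (\<lambda>x. coeff (c x) j)" and "\<And>x. degree (c x) \<le> N"
  obtains q :: "real poly"
  where "\<And>t. poly q t = (\<integral>x. poly (c x) t \<partial>M)" and "\<And>j. coeff q j = (\<integral>x. coeff (c x) j \<partial>M)"
proof
  let ?q = "\<Sum>i\<le>N. monom (\<integral>x. coeff (c x) i \<partial>M) i"
  fix t
  have "poly (c x) t = (\<Sum>i\<le>N. coeff (c x) i * t ^ i)" for x
    using assms(2)[of x] poly_as_sum_of_monoms'[of "c x" N, symmetric]
    by (metis (no_types, lifting) poly_monom poly_sum sum.cong)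
  then show "poly ?q t = (\<integral>x. poly (c x) t \<partial>M)"
    using assms(1) by (simp add: poly_sum poly_monom has_all_moments_integrable)
next
  fix j
  have "coeff (c x) j = 0" if "j > N" for x
    using assms(2)[of x] that by (simp add: coeff_eq_0)
  then show "coeff (\<Sum>i\<le>N. monom (\<integral>x. coeff (c x) i \<partial>M) i) j = (\<integral>x. coeff (c x) j \<partial>M)"
    by (cases "j \<le> N") (auto simp: coeff_sum)
qed

text \<open>The arguments below compare linear coefficients only; read as derivatives at 0, these
  follow from the product and power rules.\<close>

lemma coeff_1_eq_poly_pderiv: "coeff p 1 = poly (pderiv p) (0::real)"
  by (simp add: poly_0_coeff_0 coeff_pderiv)

lemma coeff_1_power_linear: "coeff ([:a, b:] ^ k) 1 = (of_nat k * a ^ (k - 1) * b :: real)"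
  unfolding coeff_1_eq_poly_pderiv by (simp add: pderiv_power pderiv_pCons)

section \<open>Stein's identity for polynomials\<close>

text \<open>A polynomial with its gradient, the latter generated by formal rules rather than by differentiation.\<close>

inductive poly_grad :: "('v::real_inner \<Rightarrow> real) \<Rightarrow> ('v \<Rightarrow> 'v) \<Rightarrow> bool" where
  linear: "poly_grad (\<lambda>x. u \<bullet> x) (\<lambda>_. u)"
| const: "poly_grad (\<lambda>_. c) (\<lambda>_. 0)"
| add: "poly_grad f F \<Longrightarrow> poly_grad g G \<Longrightarrow> poly_grad (\<lambda>x. f x + g x) (\<lambda>x. F x + G x)"
| mult: "poly_grad f F \<Longrightarrow> poly_grad g G \<Longrightarrow>
    poly_grad (\<lambda>x. f x * g x) (\<lambda>x. f x *\<^sub>R G x + g x *\<^sub>R F x)"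

lemma poly_grad_sum:
  assumes "\<And>i. i \<in> I \<Longrightarrow> poly_grad (f i) (F i)"
  shows "poly_grad (\<lambda>x. \<Sum>i\<in>I. f i x) (\<lambda>x. \<Sum>i\<in>I. F i x)"
  using assms
  by (induction I rule: infinite_finite_induct)
    (auto intro: poly_grad.add poly_grad.const[of 0])

lemma poly_grad_cmult:
  "poly_grad f F \<Longrightarrow> poly_grad (\<lambda>x. c * f x) (\<lambda>x. c *\<^sub>R F x)"
  using poly_grad.mult[OF poly_grad.const[of c]] by fastforce

lemma poly_grad_power_linear:
  "poly_grad (\<lambda>x. (w \<bullet> x) ^ k) (\<lambda>x. (of_nat k * (w \<bullet> x) ^ (k - 1)) *\<^sub>R w)"
proof (induction k)
  case 0
  show ?case using poly_grad.const[of 1] by simp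
next
  case (Suc k)
  have "(\<lambda>x. (w \<bullet> x) *\<^sub>R (of_nat k * (w \<bullet> x) ^ (k - 1)) *\<^sub>R w + (w \<bullet> x) ^ k *\<^sub>R w)
      = (\<lambda>x. (of_nat (Suc k) * (w \<bullet> x) ^ k) *\<^sub>R w)"
    by (cases k) (auto simp: fun_eq_iff algebra_simps simp flip: scaleR_add_left)
  with poly_grad.mult[OF poly_grad.linear[of w] Suc] show ?case
    by simp
qed

text \<open>The moments of the centred normal law with variance \<open>s\<close>; the double factorial \<open>(2 j - 1)!!\<close>
  appears as \<open>(2 j)! / (2^j j!)\<close>.\<close>

definition normal_moment :: "nat \<Rightarrow> real \<Rightarrow> real" where
  "normal_moment k s = (if even k then fact k / (2 ^ (k div 2) * fact (k div 2)) * s ^ (k div 2) else 0)"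

lemma prob_space_distributed_normal_moments:
  assumes "prob_space M" and D: "distributed M lborel Y (normal_density \<mu> \<sigma>)" and \<sigma>: "0 < \<sigma>"
  shows "has_all_moments M Y" and "integral\<^sup>L M Y = \<mu>"
    and "(\<integral>x. (Y x - \<mu>) ^ k \<partial>M) = normal_moment k (\<sigma>\<^sup>2)"
proof -
  interpret prob_space M by fact
  have Y: "Y \<in> borel_measurable M" using D by (auto simp: distributed_def)
  have "integrable M (\<lambda>x. \<bar>Y x - \<mu>\<bar> ^ k)" for k
    using distributed_integrable[OF D, of "\<lambda>x. \<bar>x - \<mu>\<bar> ^ k"] integrable_normal_moment_abs[OF \<sigma>, of \<mu> k]
    by simp
  then have "has_all_moments M (\<lambda>x. Y x - \<mu>)"
    using Y by (simp add: has_all_moments_def)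
  from has_all_moments_add[OF this has_all_moments_const[of \<mu>]]
  show "has_all_moments M Y" by simp
  have mom: "(\<integral>x. (Y x - \<mu>) ^ k \<partial>M) = (\<integral>x. normal_density \<mu> \<sigma> x * (x - \<mu>) ^ k \<partial>lborel)" for k
    using distributed_integral[OF D, of "\<lambda>x. (x - \<mu>) ^ k"] by simp
  show "(\<integral>x. (Y x - \<mu>) ^ k \<partial>M) = normal_moment k (\<sigma>\<^sup>2)"
  proof (cases "even k")
    case True
    then obtain j where "k = 2 * j" by (auto elim: evenE)
    then show ?thesis
      using \<sigma> integral_normal_moment_even[OF \<sigma>, of \<mu> j]
      by (simp add: mom normal_moment_def power_divide)
  next
    case False
    then obtain j where "k = 2 * j + 1" by (auto elim: oddE)
    then show ?thesis
      using integral_normal_moment_odd[OF \<sigma>, of \<mu> j] mom[of k]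
      by (simp add: normal_moment_def)
  qed
  have "integrable M (\<lambda>x. Y x)"
    using \<open>has_all_moments M Y\<close> by (rule has_all_moments_integrable)
  moreover have "(\<integral>x. Y x - \<mu> \<partial>M) = 0"
    using mom[of 1] integral_normal_moment_odd[OF \<sigma>, of \<mu> 0] by simp
  ultimately show "integral\<^sup>L M Y = \<mu>"
    by (simp add: prob_space)
qed

section \<open>Moments of linear functionals of the Gaussian vector\<close>

locale centered_gaussian_space = prob_space \<Omega> for \<Omega> :: "'a measure" +
  fixes X :: "'a \<Rightarrow> real^'r" and P :: "real^'r^'r"
  assumes centered_gaussian: "centered_gaussian \<Omega> X P" and pos_def: "pos_def P"
begin

lemma X_measurable [measurable]: "X \<in> borel_measurable \<Omega>"
  using centered_gaussian by (simp add: centered_gaussian_def gaussian_vector_def)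

lemma inner_P_commute: "u \<bullet> (P *v v) = v \<bullet> (P *v u)"
  using pos_def unfolding pos_def_def symmetric_mat_def
  by (metis dot_lmul_matrix inner_commute transpose_matrix_vector)

lemma P_self_adjoint: "(P *v u) \<bullet> v = u \<bullet> (P *v v)"
  by (metis inner_P_commute inner_commute)

lemma gaussian_cases:
  obtains (normal) \<mu> \<sigma> where "0 < \<sigma>" "distributed \<Omega> lborel (\<lambda>\<omega>. u \<bullet> X \<omega>) (normal_density \<mu> \<sigma>)"
  | (degenerate) c where "AE \<omega> in \<Omega>. u \<bullet> X \<omega> = c"
  using centered_gaussian unfolding centered_gaussian_def gaussian_vector_def by blast

lemma has_all_moments_linear: "has_all_moments \<Omega> (\<lambda>\<omega>. u \<bullet> X \<omega>)"
proof (cases u rule: gaussian_cases)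
  case (normal \<mu> \<sigma>)
  then show ?thesis
    using prob_space_distributed_normal_moments(1) prob_space_axioms by blast
next
  case (degenerate c)
  have "integrable \<Omega> (\<lambda>\<omega>. \<bar>u \<bullet> X \<omega>\<bar> ^ k)" for k
    by (rule integrable_cong_AE_imp[where g = "\<lambda>_. \<bar>c\<bar> ^ k"]) (use degenerate in auto)
  then show ?thesis by (simp add: has_all_moments_def)
qed

lemma has_all_moments_component: "has_all_moments \<Omega> (\<lambda>\<omega>. X \<omega> $ i)"
  using has_all_moments_linear[of "axis i 1"] by (simp add: inner_axis')

lemma integrable_X: "integrable \<Omega> X"
proof -
  have "integrable \<Omega> (\<lambda>\<omega>. \<Sum>b\<in>Basis. (X \<omega> \<bullet> b) *\<^sub>R b)"
    using has_all_moments_integrable[OF has_all_moments_linear]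
    by (intro Bochner_Integration.integrable_sum integrable_scaleR_left impI) (simp add: inner_commute)
  then show ?thesis by (simp only: euclidean_representation)
qed

lemma expectation_linear: "expectation (\<lambda>\<omega>. u \<bullet> X \<omega>) = 0"
  using integrable_X centered_gaussian by (simp add: centered_gaussian_def)

text \<open>Since the means vanish, the entries of the covariance matrix are the E[X_i X_j]; the
  rest is bilinear expansion in coordinates.\<close>

lemma expectation_linear_mult_linear:
  "expectation (\<lambda>\<omega>. (u \<bullet> X \<omega>) * (v \<bullet> X \<omega>)) = u \<bullet> (P *v v)"
proof -
  have 0: "expectation (\<lambda>\<omega>. X \<omega> $ i) = 0" for i
    using expectation_linear[of "axis i 1"] by (simp add: inner_axis')
  have "covariance_mat \<Omega> X = P"
    using centered_gaussian by (simp add: centered_gaussian_def)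
  then have P: "P $ i $ j = expectation (\<lambda>\<omega>. X \<omega> $ i * X \<omega> $ j)" for i j
    unfolding covariance_mat_def using 0 by auto
  have "(u \<bullet> x) * (v \<bullet> x) = (\<Sum>i\<in>UNIV. \<Sum>j\<in>UNIV. (u $ i * v $ j) * (x $ i * x $ j))" for x :: "real^'r"
    by (simp add: inner_vec_def sum_product algebra_simps)
  then have "expectation (\<lambda>\<omega>. (u \<bullet> X \<omega>) * (v \<bullet> X \<omega>))
      = expectation (\<lambda>\<omega>. \<Sum>i\<in>UNIV. \<Sum>j\<in>UNIV. (u $ i * v $ j) * (X \<omega> $ i * X \<omega> $ j))"
    by presburger
  also have "\<dots> = (\<Sum>i\<in>UNIV. expectation (\<lambda>\<omega>. \<Sum>j\<in>UNIV. (u $ i * v $ j) * (X \<omega> $ i * X \<omega> $ j)))"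
    by (intro Bochner_Integration.integral_sum has_all_moments_integrable has_all_moments_sum
        has_all_moments_cmult has_all_moments_mult has_all_moments_component)
  also have "\<dots> = (\<Sum>i\<in>UNIV. \<Sum>j\<in>UNIV. expectation (\<lambda>\<omega>. (u $ i * v $ j) * (X \<omega> $ i * X \<omega> $ j)))"
    by (intro sum.cong refl Bochner_Integration.integral_sum has_all_moments_integrable
        has_all_moments_cmult has_all_moments_mult has_all_moments_component)
  also have "\<dots> = u \<bullet> (P *v v)"
    by (simp add: inner_vec_def matrix_vector_mult_def P sum_distrib_left algebra_simps)
  finally show ?thesis .
qed

lemma expectation_linear_power:
  "expectation (\<lambda>\<omega>. (u \<bullet> X \<omega>) ^ k) = normal_moment k (u \<bullet> (P *v u))"
proof (cases u rule: gaussian_cases)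
  case (normal \<mu> \<sigma>)
  note m = prob_space_distributed_normal_moments[OF prob_space_axioms normal(2,1)]
  have \<mu>: "\<mu> = 0" using m(2) expectation_linear by simp
  \<comment> \<open>The parameter \<sigma> of the density is identified through the second
    moment.\<close>
  have "u \<bullet> (P *v u) = expectation (\<lambda>\<omega>. (u \<bullet> X \<omega> - \<mu>) ^ 2)"
    using expectation_linear_mult_linear[of u u] by (simp add: \<mu> power2_eq_square)
  also have "\<dots> = \<sigma>\<^sup>2" by (simp only: m(3)) (simp add: normal_moment_def)
  finally show ?thesis using m(3)[of k] \<mu> by simp
next
  case (degenerate c)
  have E: "expectation (\<lambda>\<omega>. g (u \<bullet> X \<omega>)) = g c" if [measurable]: "g \<in> borel_measurable borel" for g :: "real \<Rightarrow> real"
    using degenerate by (subst integral_cong_AE[where g = "\<lambda>_. g c"]) (auto simp: prob_space)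
  \<comment> \<open>Centring forces the point mass to sit at 0, so the variance vanishes as well and
    both sides are \<open>0 ^ k\<close>. The zero functional is of this kind.\<close>
  have c: "c = 0" using expectation_linear[of u] E[of "\<lambda>x. x"] by simp
  have "u \<bullet> (P *v u) = 0"
    using expectation_linear_mult_linear[of u u] E[of "\<lambda>x. x * x"] c by simp
  moreover have "expectation (\<lambda>\<omega>. (u \<bullet> X \<omega>) ^ k) = 0 ^ k"
    using E[of "\<lambda>x. x ^ k"] c by simp
  ultimately show ?thesis
    by (cases "k = 0") (auto simp: normal_moment_def zero_power elim!: evenE)
qed

lemma has_all_moments_poly_grad:
  assumes "poly_grad f F"
  shows "has_all_moments \<Omega> (\<lambda>\<omega>. f (X \<omega>))" and "has_all_moments \<Omega> (\<lambda>\<omega>. z \<bullet> F (X \<omega>))"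
  using assms
proof (induction arbitrary: z rule: poly_grad.induct)
  case (mult f F g G)
  have "has_all_moments \<Omega> (\<lambda>\<omega>. f (X \<omega>) * (z \<bullet> G (X \<omega>)) + g (X \<omega>) * (z \<bullet> F (X \<omega>)))" for z
    using mult.IH by (intro has_all_moments_add has_all_moments_mult)
  then show "has_all_moments \<Omega> (\<lambda>\<omega>. z \<bullet> (f (X \<omega>) *\<^sub>R G (X \<omega>) + g (X \<omega>) *\<^sub>R F (X \<omega>)))" for z
    by (simp add: inner_add_right)
  show "has_all_moments \<Omega> (\<lambda>\<omega>. f (X \<omega>) * g (X \<omega>))"
    using mult.IH by (intro has_all_moments_mult)
qed (auto simp: inner_add_right intro: has_all_moments_linear has_all_moments_const has_all_moments_add)

text \<open>F plays the role of the gradient of f. The property is visibly stable under linear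
  combinations but not under products, which is why \<open>stein_powers\<close> strengthens
  it.\<close>

definition stein :: "(real^'r \<Rightarrow> real) \<Rightarrow> (real^'r \<Rightarrow> real^'r) \<Rightarrow> bool" where
  "stein f F \<longleftrightarrow> (\<forall>u. expectation (\<lambda>\<omega>. (u \<bullet> X \<omega>) * f (X \<omega>)) = expectation (\<lambda>\<omega>. (P *v u) \<bullet> F (X \<omega>)))"

lemma stein_add:
  assumes "poly_grad f F" "poly_grad g G" "stein f F" "stein g G"
  shows "stein (\<lambda>x. f x + g x) (\<lambda>x. F x + G x)"
  unfolding stein_def
proof
  fix u
  note I = has_all_moments_integrable[OF has_all_moments_poly_grad(2)]
    has_all_moments_integrable[OF has_all_moments_mult[OF has_all_moments_linear[of u] has_all_moments_poly_grad(1)]]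
  have "expectation (\<lambda>\<omega>. (u \<bullet> X \<omega>) * (f (X \<omega>) + g (X \<omega>)))
      = expectation (\<lambda>\<omega>. (u \<bullet> X \<omega>) * f (X \<omega>)) + expectation (\<lambda>\<omega>. (u \<bullet> X \<omega>) * g (X \<omega>))"
    by (simp add: distrib_left I[OF assms(1)] I[OF assms(2)])
  also have "\<dots> = expectation (\<lambda>\<omega>. (P *v u) \<bullet> (F (X \<omega>) + G (X \<omega>)))"
    using assms(3,4) by (simp add: stein_def inner_add_right I[OF assms(1)] I[OF assms(2)])
  finally show "expectation (\<lambda>\<omega>. (u \<bullet> X \<omega>) * (f (X \<omega>) + g (X \<omega>)))
      = expectation (\<lambda>\<omega>. (P *v u) \<bullet> (F (X \<omega>) + G (X \<omega>)))" .
qed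

lemma stein_cmult:
  assumes "stein f F"
  shows "stein (\<lambda>x. c * f x) (\<lambda>x. c *\<^sub>R F x)"
  using assms by (simp add: stein_def mult.left_commute)

text \<open>The moment of order k + 1 of (w + t u) \<bullet> X is a polynomial in t, and it is also
  a constant times a power of the variance, which is quadratic in t. The linear coefficients of
  these two expressions give the identity.\<close>

lemma stein_linear_power: "stein (\<lambda>x. (w \<bullet> x) ^ k) (\<lambda>x. (of_nat k * (w \<bullet> x) ^ (k - 1)) *\<^sub>R w)"
  unfolding stein_def
proof
  fix u
  let ?c = "\<lambda>\<omega>. [:w \<bullet> X \<omega>, u \<bullet> X \<omega>:] ^ Suc k"
  have "degree (?c \<omega>) \<le> Suc k" for \<omega>
    using degree_power_le[of "[:w \<bullet> X \<omega>, u \<bullet> X \<omega>:]" "Suc k"] by (auto intro: order_trans)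
  moreover have "has_all_moments \<Omega> (\<lambda>\<omega>. coeff (?c \<omega>) j)" for j
    by (intro has_all_moments_coeff_power has_all_moments_coeff_linear has_all_moments_linear)
  ultimately obtain q where q: "\<And>t. poly q t = expectation (\<lambda>\<omega>. poly (?c \<omega>) t)"
    "\<And>j. coeff q j = expectation (\<lambda>\<omega>. coeff (?c \<omega>) j)"
    using integral_poly[of \<Omega> ?c "Suc k"] by blast
  let ?\<alpha> = "w \<bullet> (P *v w)" and ?\<beta> = "u \<bullet> (P *v w)" and ?\<gamma> = "u \<bullet> (P *v u)"
  have pq: "poly q t = normal_moment (Suc k) (poly [:?\<alpha>, 2 * ?\<beta>, ?\<gamma>:] t)" for t
  proof -
    have "poly q t = expectation (\<lambda>\<omega>. ((w + t *\<^sub>R u) \<bullet> X \<omega>) ^ Suc k)"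
      by (simp add: q inner_add_left mult.commute del: power_Suc)
    also have "\<dots> = normal_moment (Suc k) ((w + t *\<^sub>R u) \<bullet> (P *v (w + t *\<^sub>R u)))"
      by (rule expectation_linear_power)
    also have "(w + t *\<^sub>R u) \<bullet> (P *v (w + t *\<^sub>R u)) = poly [:?\<alpha>, 2 * ?\<beta>, ?\<gamma>:] t"
      using inner_P_commute[of w u]
      by (simp add: matrix_vector_right_distrib matrix_vector_mult_scaleR inner_add_left inner_add_right algebra_simps)
    finally show ?thesis .
  qed
  have c1: "coeff q 1 = of_nat (Suc k) * expectation (\<lambda>\<omega>. (u \<bullet> X \<omega>) * (w \<bullet> X \<omega>) ^ k)"
  proof -
    have "coeff (?c \<omega>) 1 = of_nat (Suc k) * ((u \<bullet> X \<omega>) * (w \<bullet> X \<omega>) ^ k)" for \<omega>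
      unfolding coeff_1_power_linear by simp
    then show ?thesis unfolding q(2) by (simp only: integral_mult_right_zero)
  qed
  have rhs: "expectation (\<lambda>\<omega>. (P *v u) \<bullet> ((of_nat k * (w \<bullet> X \<omega>) ^ (k - 1)) *\<^sub>R w))
      = of_nat k * ?\<beta> * normal_moment (k - 1) ?\<alpha>"
    using expectation_linear_power[of w "k - 1"] P_self_adjoint[of u w]
    by (simp add: mult.commute mult.assoc)
  show "expectation (\<lambda>\<omega>. (u \<bullet> X \<omega>) * (w \<bullet> X \<omega>) ^ k)
      = expectation (\<lambda>\<omega>. (P *v u) \<bullet> ((of_nat k * (w \<bullet> X \<omega>) ^ (k - 1)) *\<^sub>R w))"
  proof (cases "even k")
    case True
    \<comment> \<open>The moment of odd order k + 1 vanishes for every t. On the other side k - 1 is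
      odd too, except for k = 0, where the factor k makes the truncated subtraction
      harmless.\<close>
    have "poly q = poly 0" by (rule ext) (use True pq in \<open>simp add: normal_moment_def\<close>)
    then have "coeff q 1 = 0" by (simp only: poly_eq_poly_eq_iff coeff_0)
    then show ?thesis unfolding rhs c1 using True by (cases "k = 0") (simp_all add: normal_moment_def)
  next
    case False
    then obtain i where k: "k = 2 * i + 1" by (auto elim: oddE)
    let ?C = "fact (Suc k) / (2 ^ Suc i * fact (Suc i)) :: real"
    have "poly q = poly (smult ?C ([:?\<alpha>, 2 * ?\<beta>, ?\<gamma>:] ^ Suc i))"
      by (rule ext) (simp add: pq normal_moment_def k algebra_simps)
    then have "q = smult ?C ([:?\<alpha>, 2 * ?\<beta>, ?\<gamma>:] ^ Suc i)"
      by (simp only: poly_eq_poly_eq_iff)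
    then have "coeff q 1 = ?C * (of_nat (Suc i) * ?\<alpha> ^ i * (2 * ?\<beta>))"
      unfolding coeff_1_eq_poly_pderiv
      by (simp only:) (simp add: pderiv_smult pderiv_power pderiv_pCons del: power_Suc)
    also have "\<dots> = of_nat (Suc k) * (of_nat k * ?\<beta> * normal_moment (k - 1) ?\<alpha>)"
    proof -
      \<comment> \<open>The recursion (2 i + 1)!! = (2 i + 1) (2 i - 1)!!, with k = 2 i + 1.\<close>
      have "?C = (2 * (real i + 1)) * (of_nat k * fact (2 * i)) / ((2 * (real i + 1)) * (2 ^ i * fact i))"
        by (simp add: k algebra_simps)
      also have "\<dots> = of_nat k * fact (2 * i) / (2 ^ i * fact i)"
        by (rule mult_divide_mult_cancel_left) simp
      finally have "?C = of_nat k * fact (2 * i) / (2 ^ i * fact i)" .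
      then show ?thesis
        by (simp only:) (simp add: k normal_moment_def algebra_simps add_divide_distrib)
    qed
    finally show ?thesis
      unfolding rhs c1 by simp
  qed
qed

text \<open>Polarisation: the factor \<open>z \<bullet> x\<close> is split off from \<open>((w + t z) \<bullet> x) ^ (k + 1)\<close> by comparing
  coefficients of \<open>t\<close>.\<close>

definition stein_powers :: "(real^'r \<Rightarrow> real) \<Rightarrow> (real^'r \<Rightarrow> real^'r) \<Rightarrow> bool" where
  "stein_powers p Q \<longleftrightarrow> poly_grad p Q \<and>
     (\<forall>w k. stein (\<lambda>x. p x * (w \<bullet> x) ^ k) (\<lambda>x. p x *\<^sub>R ((of_nat k * (w \<bullet> x) ^ (k - 1)) *\<^sub>R w) + (w \<bullet> x) ^ k *\<^sub>R Q x))"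

text \<open>The hypothesis holds for all vectors and exponents, so it may be used at w + t z with
  exponent \<open>Suc k\<close>. Both sides are polynomials in t whose linear coefficients are
  \<open>Suc k\<close> times the two sides of the claim.\<close>

lemma stein_powers_linear_mult:
  assumes "stein_powers p Q"
  shows "stein_powers (\<lambda>x. (z \<bullet> x) * p x) (\<lambda>x. (z \<bullet> x) *\<^sub>R Q x + p x *\<^sub>R z)"
  unfolding stein_powers_def
proof (intro conjI allI)
  have pQ: "poly_grad p Q" using assms by (simp add: stein_powers_def)
  then show "poly_grad (\<lambda>x. (z \<bullet> x) * p x) (\<lambda>x. (z \<bullet> x) *\<^sub>R Q x + p x *\<^sub>R z)"
    by (intro poly_grad.mult poly_grad.linear)
  fix w k
  show "stein (\<lambda>x. (z \<bullet> x) * p x * (w \<bullet> x) ^ k)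
      (\<lambda>x. ((z \<bullet> x) * p x) *\<^sub>R ((of_nat k * (w \<bullet> x) ^ (k - 1)) *\<^sub>R w)
        + (w \<bullet> x) ^ k *\<^sub>R ((z \<bullet> x) *\<^sub>R Q x + p x *\<^sub>R z))"
    unfolding stein_def
  proof
    fix u
    define v where "v = P *v u"
    let ?l = "\<lambda>x. [:w \<bullet> x, z \<bullet> x:]"
    \<comment> \<open>\<open>?c1\<close> and \<open>?c2\<close> are the two integrands of the
      hypothesis at w + t z, written as polynomials in t.\<close>
    let ?c1 = "\<lambda>x. [:(u \<bullet> x) * p x:] * ?l x ^ Suc k"
    let ?c2 = "\<lambda>x. [:of_nat (Suc k) * p x:] * (?l x ^ k * [:v \<bullet> w, v \<bullet> z:]) + [:v \<bullet> Q x:] * ?l x ^ Suc k"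
    have deg: "degree (?l x ^ n) \<le> n" for x n
      using degree_power_le[of "?l x" n] by (auto intro: order_trans)
    have hc: "has_all_moments \<Omega> (\<lambda>\<omega>. coeff [:g \<omega>:] j)" if "has_all_moments \<Omega> g" for g j
      using that has_all_moments_const[of 0] by (cases j) auto
    have hl: "has_all_moments \<Omega> (\<lambda>\<omega>. coeff (?l (X \<omega>)) j)" for j
      by (intro has_all_moments_coeff_linear has_all_moments_linear)
    have h1: "has_all_moments \<Omega> (\<lambda>\<omega>. coeff (?c1 (X \<omega>)) j)" for j
      by (intro has_all_moments_coeff_mult hc hl has_all_moments_coeff_power has_all_moments_mult
          has_all_moments_linear has_all_moments_poly_grad(1)[OF pQ])
    have h2: "has_all_moments \<Omega> (\<lambda>\<omega>. coeff (?c2 (X \<omega>)) j)" for j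
      unfolding coeff_add
      by (intro has_all_moments_add has_all_moments_coeff_mult hc hl has_all_moments_coeff_power has_all_moments_cmult
          has_all_moments_poly_grad[OF pQ] has_all_moments_coeff_linear has_all_moments_const)
    have d1: "degree (?c1 x) \<le> Suc k" for x
      using degree_mult_le[of "[:(u \<bullet> x) * p x:]" "?l x ^ Suc k"] deg[of x "Suc k"] by simp
    have d2: "degree (?c2 x) \<le> Suc k" for x
    proof (rule degree_add_le)
      have "degree (?l x ^ k * [:v \<bullet> w, v \<bullet> z:]) \<le> k + 1"
        using degree_mult_le[of "?l x ^ k" "[:v \<bullet> w, v \<bullet> z:]"] deg[of x k] degree_pCons_le[of "v \<bullet> w" "[:v \<bullet> z:]"]
        by simp
      then show "degree ([:of_nat (Suc k) * p x:] * (?l x ^ k * [:v \<bullet> w, v \<bullet> z:])) \<le> Suc k"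
        using degree_mult_le[of "[:of_nat (Suc k) * p x:]" "?l x ^ k * [:v \<bullet> w, v \<bullet> z:]"] by simp
      show "degree ([:v \<bullet> Q x:] * ?l x ^ Suc k) \<le> Suc k"
        using degree_mult_le[of "[:v \<bullet> Q x:]" "?l x ^ Suc k"] deg[of x "Suc k"] by simp
    qed
    obtain q1 where q1: "\<And>t. poly q1 t = expectation (\<lambda>\<omega>. poly (?c1 (X \<omega>)) t)"
      "\<And>j. coeff q1 j = expectation (\<lambda>\<omega>. coeff (?c1 (X \<omega>)) j)"
      using integral_poly[OF h1 d1] by blast
    obtain q2 where q2: "\<And>t. poly q2 t = expectation (\<lambda>\<omega>. poly (?c2 (X \<omega>)) t)"
      "\<And>j. coeff q2 j = expectation (\<lambda>\<omega>. coeff (?c2 (X \<omega>)) j)"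
      using integral_poly[OF h2 d2] by blast
    have "poly q1 t = poly q2 t" for t
    proof -
      let ?w = "w + t *\<^sub>R z"
      have 1: "poly (?c1 x) t = (u \<bullet> x) * (p x * (?w \<bullet> x) ^ Suc k)" for x
        by (simp add: inner_add_left mult_ac del: power_Suc)
      have 2: "poly (?c2 x) t = v \<bullet> (p x *\<^sub>R ((of_nat (Suc k) * (?w \<bullet> x) ^ (Suc k - 1)) *\<^sub>R ?w) + (?w \<bullet> x) ^ Suc k *\<^sub>R Q x)" for x
        by (simp add: inner_add_left inner_add_right algebra_simps)
      show ?thesis
        unfolding q1 q2 1 2 unfolding v_def
        using assms by (simp only: stein_powers_def stein_def)
    qed
    then have E: "coeff q1 1 = coeff q2 1"
      using poly_eq_poly_eq_iff[of q1 q2] by auto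
    have E1: "coeff (?c1 x) 1 = of_nat (Suc k) * ((u \<bullet> x) * ((z \<bullet> x) * p x * (w \<bullet> x) ^ k))" for x
      unfolding coeff_1_eq_poly_pderiv
      by (simp add: pderiv_mult pderiv_smult pderiv_power_Suc pderiv_pCons algebra_simps del: power_Suc)
    have E2: "coeff (?c2 x) 1 = of_nat (Suc k) * (v \<bullet> (((z \<bullet> x) * p x) *\<^sub>R ((of_nat k * (w \<bullet> x) ^ (k - 1)) *\<^sub>R w)
        + (w \<bullet> x) ^ k *\<^sub>R ((z \<bullet> x) *\<^sub>R Q x + p x *\<^sub>R z)))" for x
      unfolding coeff_1_eq_poly_pderiv
      by (cases k) (simp_all add: pderiv_mult pderiv_smult pderiv_add pderiv_power_Suc pderiv_pCons inner_add_right algebra_simps del: power_Suc)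
    show "expectation (\<lambda>\<omega>. (u \<bullet> X \<omega>) * ((z \<bullet> X \<omega>) * p (X \<omega>) * (w \<bullet> X \<omega>) ^ k)) =
        expectation (\<lambda>\<omega>. (P *v u) \<bullet> (((z \<bullet> X \<omega>) * p (X \<omega>)) *\<^sub>R ((of_nat k * (w \<bullet> X \<omega>) ^ (k - 1)) *\<^sub>R w)
          + (w \<bullet> X \<omega>) ^ k *\<^sub>R ((z \<bullet> X \<omega>) *\<^sub>R Q (X \<omega>) + p (X \<omega>) *\<^sub>R z)))"
      using E unfolding q1(2) q2(2) E1 E2 integral_mult_right_zero v_def[symmetric] by simp
  qed
qed

lemma stein_powers_one: "stein_powers (\<lambda>_. 1) (\<lambda>_. 0)"
  using stein_linear_power poly_grad.const[of 1] by (simp add: stein_powers_def)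

lemma stein_powers_cmult:
  assumes "stein_powers p Q"
  shows "stein_powers (\<lambda>x. c * p x) (\<lambda>x. c *\<^sub>R Q x)"
  unfolding stein_powers_def
proof (intro conjI allI)
  show "poly_grad (\<lambda>x. c * p x) (\<lambda>x. c *\<^sub>R Q x)"
    using assms by (simp add: stein_powers_def poly_grad_cmult)
  fix w :: "real^'r" and k :: nat
  let ?D = "\<lambda>x. (of_nat k * (w \<bullet> x) ^ (k - 1)) *\<^sub>R w"
  have "stein (\<lambda>x. c * (p x * (w \<bullet> x) ^ k)) (\<lambda>x. c *\<^sub>R (p x *\<^sub>R ?D x + (w \<bullet> x) ^ k *\<^sub>R Q x))"
    using assms by (intro stein_cmult) (simp add: stein_powers_def)
  then show "stein (\<lambda>x. c * p x * (w \<bullet> x) ^ k) (\<lambda>x. (c * p x) *\<^sub>R ?D x + (w \<bullet> x) ^ k *\<^sub>R c *\<^sub>R Q x)"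
    by (simp add: algebra_simps)
qed

lemma stein_powers_add:
  assumes p: "stein_powers p Q" and p': "stein_powers p' Q'"
  shows "stein_powers (\<lambda>x. p x + p' x) (\<lambda>x. Q x + Q' x)"
  unfolding stein_powers_def
proof (intro conjI allI)
  have g: "poly_grad p Q" "poly_grad p' Q'" using p p' by (auto simp: stein_powers_def)
  then show "poly_grad (\<lambda>x. p x + p' x) (\<lambda>x. Q x + Q' x)" by (rule poly_grad.add)
  fix w :: "real^'r" and k :: nat
  let ?D = "\<lambda>x. (of_nat k * (w \<bullet> x) ^ (k - 1)) *\<^sub>R w"
  have "stein (\<lambda>x. p x * (w \<bullet> x) ^ k + p' x * (w \<bullet> x) ^ k)
     (\<lambda>x. (p x *\<^sub>R ?D x + (w \<bullet> x) ^ k *\<^sub>R Q x) + (p' x *\<^sub>R ?D x + (w \<bullet> x) ^ k *\<^sub>R Q' x))"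
    using p p' by (intro stein_add poly_grad.mult g poly_grad_power_linear) (auto simp: stein_powers_def)
  then show "stein (\<lambda>x. (p x + p' x) * (w \<bullet> x) ^ k)
      (\<lambda>x. (p x + p' x) *\<^sub>R ?D x + (w \<bullet> x) ^ k *\<^sub>R (Q x + Q' x))"
    by (simp add: algebra_simps)
qed

text \<open>f is treated as a multiplier acting on arbitrary pairs p, Q. A product f g acts as f
  after g, so the product case merely composes the two induction hypotheses.\<close>

lemma stein_powers_mult:
  assumes "poly_grad f F" and "stein_powers p Q"
  shows "stein_powers (\<lambda>x. f x * p x) (\<lambda>x. f x *\<^sub>R Q x + p x *\<^sub>R F x)"
  using assms
proof (induction arbitrary: p Q rule: poly_grad.induct)
  case (linear u)
  then show ?case by (rule stein_powers_linear_mult)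
next
  case (const c)
  then show ?case using stein_powers_cmult[of p Q c] by simp
next
  case (add f F g G)
  from stein_powers_add[OF add.IH(1)[OF add.prems] add.IH(2)[OF add.prems]]
  show ?case by (simp add: algebra_simps)
next
  case (mult f F g G)
  from mult.IH(1)[OF mult.IH(2)[OF mult.prems]]
  show ?case by (simp add: algebra_simps)
qed

lemma stein_poly_grad:
  assumes "poly_grad f F"
  shows "expectation (\<lambda>\<omega>. (u \<bullet> X \<omega>) * f (X \<omega>)) = expectation (\<lambda>\<omega>. (P *v u) \<bullet> F (X \<omega>))"
proof -
  have "stein_powers f F" using stein_powers_mult[OF assms stein_powers_one] by simp
  \<comment> \<open>Exponent 0 removes the power: \<open>(0 \<bullet> x) ^ 0\<close> is 1, and the
    derivative of the power carries the factor \<open>of_nat 0\<close>.\<close>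
  then have "stein (\<lambda>x. f x * (0 \<bullet> x) ^ 0) (\<lambda>x. f x *\<^sub>R ((of_nat 0 * (0 \<bullet> x) ^ (0 - 1)) *\<^sub>R 0) + (0 \<bullet> x) ^ 0 *\<^sub>R F x)"
    unfolding stein_powers_def by blast
  then show ?thesis by (simp add: stein_def)
qed

text \<open>The form is the sum of (b \<bullet> x) (A b \<bullet> x) over the basis. Stein's
  identity removes b \<bullet> x; differentiating A b \<bullet> x yields the trace of P A, and
  differentiating f yields its derivative along P A x.\<close>

lemma stein_quadratic:
  assumes f: "poly_grad f F" and A: "transpose A = A"
  shows "expectation (\<lambda>\<omega>. (X \<omega> \<bullet> (A *v X \<omega>)) * f (X \<omega>))
      = (\<Sum>b\<in>Basis. b \<bullet> (P *v (A *v b))) * expectation (\<lambda>\<omega>. f (X \<omega>))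
        + expectation (\<lambda>\<omega>. (P *v (A *v X \<omega>)) \<bullet> F (X \<omega>))"
proof -
  have A': "(A *v x) \<bullet> y = x \<bullet> (A *v y)" for x y
    by (metis A dot_lmul_matrix transpose_matrix_vector)
  have g: "poly_grad (\<lambda>x. ((A *v b) \<bullet> x) * f x) (\<lambda>x. ((A *v b) \<bullet> x) *\<^sub>R F x + f x *\<^sub>R (A *v b))" for b
    by (intro poly_grad.mult poly_grad.linear f)
  have i1: "integrable \<Omega> (\<lambda>\<omega>. (b \<bullet> X \<omega>) * (((A *v b) \<bullet> X \<omega>) * f (X \<omega>)))" for b
    by (intro has_all_moments_integrable has_all_moments_mult has_all_moments_linear has_all_moments_poly_grad(1)[OF f])
  have i2: "integrable \<Omega> (\<lambda>\<omega>. ((A *v b) \<bullet> X \<omega>) * (c \<bullet> F (X \<omega>)))" for b c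
    by (intro has_all_moments_integrable has_all_moments_mult has_all_moments_linear has_all_moments_poly_grad(2)[OF f])
  have i3: "integrable \<Omega> (\<lambda>\<omega>. f (X \<omega>))"
    by (intro has_all_moments_integrable has_all_moments_poly_grad(1)[OF f])
  have "(x \<bullet> (A *v x)) * y = (\<Sum>b\<in>Basis. (b \<bullet> x) * (((A *v b) \<bullet> x) * y))" for x y
  proof -
    have "(x \<bullet> b) * ((A *v x) \<bullet> b) * y = (b \<bullet> x) * (((A *v b) \<bullet> x) * y)" for b
      using A'[of x b] inner_commute[of b x] inner_commute[of "A *v b" x] by simp
    then show ?thesis
      by (subst euclidean_inner) (simp only: sum_distrib_right)
  qed
  then have "expectation (\<lambda>\<omega>. (X \<omega> \<bullet> (A *v X \<omega>)) * f (X \<omega>))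
      = (\<Sum>b\<in>Basis. expectation (\<lambda>\<omega>. (b \<bullet> X \<omega>) * (((A *v b) \<bullet> X \<omega>) * f (X \<omega>))))"
    by (simp add: i1)
  also have "\<dots> = (\<Sum>b\<in>Basis. expectation (\<lambda>\<omega>. (P *v b) \<bullet> (((A *v b) \<bullet> X \<omega>) *\<^sub>R F (X \<omega>) + f (X \<omega>) *\<^sub>R (A *v b))))"
    by (simp only: stein_poly_grad[OF g])
  also have "\<dots> = (\<Sum>b\<in>Basis. (b \<bullet> (P *v (A *v b))) * expectation (\<lambda>\<omega>. f (X \<omega>)))
      + (\<Sum>b\<in>Basis. expectation (\<lambda>\<omega>. ((A *v b) \<bullet> X \<omega>) * ((P *v b) \<bullet> F (X \<omega>))))"
    unfolding sum.distrib[symmetric]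
    by (rule sum.cong[OF refl]) (simp add: inner_add_right i2 i3 P_self_adjoint[of b "A *v b" for b])
  also have "(\<Sum>b\<in>Basis. expectation (\<lambda>\<omega>. ((A *v b) \<bullet> X \<omega>) * ((P *v b) \<bullet> F (X \<omega>))))
      = expectation (\<lambda>\<omega>. \<Sum>b\<in>Basis. ((A *v b) \<bullet> X \<omega>) * ((P *v b) \<bullet> F (X \<omega>)))"
    by (simp add: i2)
  also have "(\<lambda>\<omega>. \<Sum>b\<in>Basis. ((A *v b) \<bullet> X \<omega>) * ((P *v b) \<bullet> F (X \<omega>))) = (\<lambda>\<omega>. (P *v (A *v X \<omega>)) \<bullet> F (X \<omega>))"
  proof -
    have "((A *v b) \<bullet> x) * ((P *v b) \<bullet> y) = ((A *v x) \<bullet> b) * ((P *v y) \<bullet> b)" for b x y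
      by (simp only: A' P_self_adjoint inner_commute[of b] inner_commute[of "P *v y"])
    then have "(\<Sum>b\<in>Basis. ((A *v b) \<bullet> x) * ((P *v b) \<bullet> y)) = (P *v (A *v x)) \<bullet> y" for x y
      unfolding P_self_adjoint[of "A *v x"] euclidean_inner[of "A *v x" "P *v y"] by (intro sum.cong refl)
    then show ?thesis by simp
  qed
  finally show ?thesis by (simp add: sum_distrib_right)
qed

end

section \<open>Moments of products of quadratic forms\<close>

lemma bounded_bilinear_matrix_mult:
  "bounded_bilinear ((**) :: real^'n^'m \<Rightarrow> real^'p^'n \<Rightarrow> real^'p^'m)"
  unfolding bilinear_conv_bounded_bilinear[symmetric] bilinear_def
  by (auto intro!: linearI simp: matrix_matrix_mult_def vec_eq_iff sum.distrib algebra_simps sum_distrib_left)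

interpretation matrix_mult: bounded_bilinear "(**) :: real^'n^'n \<Rightarrow> real^'n^'n \<Rightarrow> real^'n^'n"
  by (rule bounded_bilinear_matrix_mult)

lemma bounded_linear_matrix_form:
  "bounded_linear (\<lambda>A :: real^'n^'m. y \<bullet> (A *v z))"
  unfolding linear_conv_bounded_linear[symmetric]
  by (rule linearI)
    (simp_all add: matrix_vector_mult_add_rdistrib inner_add_right scaleR_matrix_vector_assoc[symmetric])

text \<open>Reduces identities between matrix moments to scalar expectations, to which Stein's
  identity applies.\<close>

lemma matrix_eq_form:
  fixes A B :: "real^'n^'m"
  assumes "\<And>y z. y \<bullet> (A *v z) = y \<bullet> (B *v z)"
  shows "A = B"
  using assms by (metis matrix_eq vector_eq_rdot inner_commute)

lemma inner_matrix_vector_axis: "axis i 1 \<bullet> (A *v axis j 1) = (A :: real^'n^'m) $ i $ j"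
  by (simp add: inner_axis' matrix_vector_mul_component inner_axis)

lemma integrable_matrix:
  fixes A :: "'a \<Rightarrow> real^'n^'m"
  assumes "\<And>y z. integrable M (\<lambda>x. y \<bullet> (A x *v z))"
  shows "integrable M A"
proof -
  have "integrable M (\<lambda>x. A x \<bullet> b)" if b: "b \<in> Basis" for b
  proof -
    obtain i j where "b = axis i (axis j 1)"
      using b unfolding Basis_vec_def Basis_real_def by blast
    then show ?thesis
      using assms[of "axis i 1" "axis j 1"] by (simp add: inner_matrix_vector_axis inner_axis)
  qed
  then have "integrable M (\<lambda>x. \<Sum>b\<in>Basis. (A x \<bullet> b) *\<^sub>R b)"
    by (intro Bochner_Integration.integrable_sum integrable_scaleR_left impI)
  then show ?thesis by (simp only: euclidean_representation)
qed

lemma inner_integral_matrix_vector: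
  fixes A :: "'a \<Rightarrow> real^'n^'m"
  assumes "integrable M A"
  shows "y \<bullet> (integral\<^sup>L M A *v z) = (\<integral>x. y \<bullet> (A x *v z) \<partial>M)"
  using integral_bounded_linear[OF bounded_linear_matrix_form assms, of y z] by simp

lemma mpow_commute: "mpow A k ** A = A ** mpow A k"
  by (induction k) (simp_all add: matrix_mul_assoc[symmetric])

lemma mpow_add: "mpow A (j + k) = mpow A j ** mpow A k"
  by (induction j) (simp_all add: matrix_mul_assoc)

lemma transpose_mpow: "transpose A = A \<Longrightarrow> transpose (mpow A k) = mpow A k"
  by (induction k) (simp_all add: matrix_transpose_mul mpow_commute)

lemma inner_mpow_shift:
  assumes "transpose A = A"
  shows "(mpow A i *v x) \<bullet> (mpow A j *v y) = x \<bullet> (mpow A (i + j) *v y)"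
  using dot_lmul_matrix[of x "mpow A i" "mpow A j *v y"] transpose_matrix_vector[of "mpow A i" x]
    transpose_mpow[OF assms, of i]
  by (simp add: mpow_add matrix_vector_mul_assoc)

lemma outer_component: "outer x $ i $ j = x $ i * x $ j"
  by (simp add: outer_def columnvector_def rowvector_def matrix_matrix_mult_def)

lemma outer_vector: "outer x *v z = (x \<bullet> z) *\<^sub>R x"
  by (simp add: vec_eq_iff matrix_vector_mult_def outer_component inner_vec_def sum_distrib_left mult_ac)

lemma inner_scaleR_outer_vector: "y \<bullet> ((c *\<^sub>R outer x) *v z) = c * ((y \<bullet> x) * (z \<bullet> x))"
  using inner_commute[of x z] by (simp add: scaleR_matrix_vector_assoc[symmetric] outer_vector)

text \<open>In x x' A x x' B the middle part x' A x is a scalar. This collapse turns words into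
  products of quadratic forms.\<close>

lemma outer_sandwich: "outer x ** (A ** (outer x ** B)) = (x \<bullet> (A *v x)) *\<^sub>R (outer x ** B)"
  by (simp add: matrix_eq matrix_vector_mul_assoc[symmetric] outer_vector matrix_vector_mult_scaleR
      scaleR_matrix_vector_assoc[symmetric])

text \<open>Each c \<le> n arises from 1 + c pairs with a + b = c. This count is the source both of
  the weight in W and of the derivative of the series.\<close>

lemma sum_triangle_add:
  fixes f :: "nat \<Rightarrow> 'v::real_vector"
  shows "(\<Sum>a\<le>n. \<Sum>b\<le>n - a. f (a + b)) = (\<Sum>c\<le>n. (1 + real c) *\<^sub>R f c)"
proof (induction n)
  case (Suc n)
  have "(\<Sum>a\<le>Suc n. \<Sum>b\<le>Suc n - a. f (a + b)) = (\<Sum>a\<le>n. (\<Sum>b\<le>n - a. f (a + b)) + f (Suc n)) + f (Suc n)"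
    by (simp add: Suc_diff_le)
  also have "\<dots> = (\<Sum>c\<le>Suc n. (1 + real c) *\<^sub>R f c)"
    by (simp only: sum.distrib Suc.IH) (simp add: algebra_simps sum_constant_scaleR)
  finally show ?case .
qed simp

lemma poly_grad_quadratic:
  assumes "transpose A = (A :: real^'n^'n)"
  shows "poly_grad (\<lambda>x. x \<bullet> (A *v x)) (\<lambda>x. 2 *\<^sub>R (A *v x))"
proof -
  have A: "(A *v x) \<bullet> y = x \<bullet> (A *v y)" for x y
    by (metis assms dot_lmul_matrix transpose_matrix_vector)
  have "poly_grad (\<lambda>x. \<Sum>b\<in>Basis. (b \<bullet> x) * ((A *v b) \<bullet> x))
      (\<lambda>x. \<Sum>b\<in>Basis. (b \<bullet> x) *\<^sub>R (A *v b) + ((A *v b) \<bullet> x) *\<^sub>R b)"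
    by (intro poly_grad_sum poly_grad.mult poly_grad.linear)
  moreover have "(\<Sum>b\<in>Basis. (b \<bullet> x) * ((A *v b) \<bullet> x)) = x \<bullet> (A *v x)" for x
  proof -
    have "(b \<bullet> x) * ((A *v b) \<bullet> x) = (x \<bullet> b) * ((A *v x) \<bullet> b)" for b
      using A[of x b] inner_commute[of b x] inner_commute[of "A *v b" x] by simp
    then show ?thesis
      unfolding euclidean_inner[of x "A *v x"] by (intro sum.cong refl)
  qed
  moreover have "(\<Sum>b\<in>Basis. (b \<bullet> x) *\<^sub>R (A *v b) + ((A *v b) \<bullet> x) *\<^sub>R b) = 2 *\<^sub>R (A *v x)" for x
  proof -
    have "(\<Sum>b\<in>Basis. (b \<bullet> x) *\<^sub>R (A *v b)) = A *v (\<Sum>b\<in>Basis. (x \<bullet> b) *\<^sub>R b)"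
      by (simp add: matrix_vector_mult_scaleR inner_commute
          linear_sum[OF matrix_vector_mul_linear])
    moreover have "(\<Sum>b\<in>Basis. ((A *v b) \<bullet> x) *\<^sub>R b) = (\<Sum>b\<in>Basis. ((A *v x) \<bullet> b) *\<^sub>R b)"
    proof (rule sum.cong[OF refl])
      show "((A *v b) \<bullet> x) *\<^sub>R b = ((A *v x) \<bullet> b) *\<^sub>R b" for b
        using A[of b x] inner_commute[of b "A *v x"] by simp
    qed
    ultimately show ?thesis
      by (simp add: sum.distrib euclidean_representation scaleR_2)
  qed
  ultimately show ?thesis by simp
qed

section \<open>Powers of the series of quadratic forms; from here on \<open>$\<close> takes its
  coefficients\<close>

unbundle no vec_syntax
unbundle fps_syntax

text \<open>The coefficient of \<open>s^j\<close> in the \<open>m\<close>-th power of this series is the sum of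
  \<open>\<Prod>i=1..m. x \<bullet> A^v\<^sub>i x\<close> over all \<open>v \<in> \<nat>^m\<close> with \<open>v\<^sub>1 + \<dots> + v\<^sub>m = j\<close>.\<close>

definition quad_series :: "real^'n^'n \<Rightarrow> real^'n \<Rightarrow> real fps" where
  "quad_series A x = Abs_fps (\<lambda>a. x \<bullet> (mpow A a *v x))"

text \<open>Along A^(a + 1) x the form q(b) has derivative 2 q(a + 1 + b), so this derivation acts
  on the series as twice a shift. The Leibniz rule does the rest, by induction on m.\<close>

lemma poly_grad_quad_series_power:
  fixes A :: "real^'n^'n"
  assumes A: "transpose A = A"
  obtains H where "\<And>j. poly_grad (\<lambda>x. (quad_series A x ^ m) $ j) (H j)"
    and "\<And>j a x. (mpow A (Suc a) *v x) \<bullet> H j x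
      = 2 * ((of_nat m * quad_series A x ^ (m - 1)) * Abs_fps (\<lambda>b. quad_series A x $ Suc (a + b))) $ j"
proof (induction m arbitrary: thesis)
  case 0
  show ?case
    by (rule 0[of "\<lambda>_ _. 0"]) (simp_all add: fps_one_nth poly_grad.const)
next
  case (Suc m)
  obtain H where H: "\<And>j. poly_grad (\<lambda>x. (quad_series A x ^ m) $ j) (H j)"
    "\<And>j a x. (mpow A (Suc a) *v x) \<bullet> H j x
      = 2 * ((of_nat m * quad_series A x ^ (m - 1)) * Abs_fps (\<lambda>b. quad_series A x $ Suc (a + b))) $ j"
    using that by (rule Suc.IH)
  define H' where "H' j x = (\<Sum>i=0..j. (quad_series A x $ i) *\<^sub>R H (j - i) x
    + ((quad_series A x ^ m) $ (j - i)) *\<^sub>R (2 *\<^sub>R (mpow A i *v x)))" for j x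
  show ?case
  proof (rule Suc.prems)
    show "poly_grad (\<lambda>x. (quad_series A x ^ Suc m) $ j) (H' j)" for j
      unfolding power_Suc fps_mult_nth H'_def
      using poly_grad_quadratic[OF transpose_mpow[OF A]]
      by (intro poly_grad_sum poly_grad.mult H) (simp add: quad_series_def)
    fix j a x
    let ?q = "quad_series A x"
    let ?s = "Abs_fps (\<lambda>b. ?q $ Suc (a + b))"
    have "(mpow A (Suc a) *v x) \<bullet> (mpow A i *v x) = ?s $ i" for i
      using inner_mpow_shift[OF A, of "Suc a" x i x] by (simp add: quad_series_def)
    then have "(mpow A (Suc a) *v x) \<bullet> H' j x
        = 2 * ((?q * (of_nat m * ?q ^ (m - 1) * ?s)) $ j + (?s * ?q ^ m) $ j)"
      unfolding H'_def inner_sum_right fps_mult_nth[of ?q] fps_mult_nth[of ?s] sum.distrib[symmetric] sum_distrib_left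
      by (intro sum.cong refl) (simp add: inner_add_right H(2) algebra_simps del: mpow.simps)
    also have "\<dots> = 2 * ((of_nat m * (?q * ?q ^ (m - 1)) + ?q ^ m) * ?s) $ j"
    proof -
      have "?q * (of_nat m * ?q ^ (m - 1) * ?s) + ?s * ?q ^ m = (of_nat m * (?q * ?q ^ (m - 1)) + ?q ^ m) * ?s"
        by (simp add: algebra_simps)
      then show ?thesis by (simp only: fps_add_nth[symmetric])
    qed
    \<comment> \<open>For m = 0 the exponent \<open>m - 1\<close> is truncated, but its term has the
      factor \<open>of_nat m\<close>.\<close>
    also have "of_nat m * (?q * ?q ^ (m - 1)) + ?q ^ m = of_nat (Suc m) * ?q ^ (Suc m - 1)"
      by (cases m) (simp_all add: algebra_simps)
    finally show "(mpow A (Suc a) *v x) \<bullet> H' j x = 2 * (of_nat (Suc m) * ?q ^ (Suc m - 1) * ?s) $ j" .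
  qed
qed

text \<open>The coefficient of index c + 1 of q is met once for each pair a + b = c, hence c + 1
  times, exactly as in the derivative of q.\<close>

lemma sum_shifted_series:
  fixes q R :: "real fps"
  shows "(\<Sum>a\<le>j. (R * Abs_fps (\<lambda>b. q $ Suc (a + b))) $ (j - a)) = (R * fps_deriv q) $ j"
proof -
  have "(R * Abs_fps (\<lambda>b. q $ Suc (a + b))) $ (j - a) = (\<Sum>b\<le>j - a. q $ Suc (a + b) * R $ (j - (a + b)))" for a
    by (simp add: mult.commute[of R] fps_mult_nth atMost_atLeast0)
  then have "(\<Sum>a\<le>j. (R * Abs_fps (\<lambda>b. q $ Suc (a + b))) $ (j - a))
      = (\<Sum>c\<le>j. (1 + real c) *\<^sub>R (q $ Suc c * R $ (j - c)))"
    using sum_triangle_add[of "\<lambda>c. q $ Suc c * R $ (j - c)" j] by simp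
  also have "\<dots> = (fps_deriv q * R) $ j"
    by (simp add: fps_mult_nth atMost_atLeast0 mult.assoc)
  finally show ?thesis by (simp only: mult.commute)
qed

section \<open>The matrix moments and their recursion\<close>

context centered_gaussian_space
begin

lemma transpose_P: "transpose P = P"
  using pos_def by (simp add: pos_def_def symmetric_mat_def)

text \<open>The matrices B(m, j) of the overview.\<close>

definition quad_moment :: "nat \<Rightarrow> nat \<Rightarrow> real^'r^'r" where
  "quad_moment m j = (\<integral>\<omega>. ((quad_series P (X \<omega>) ^ m) $ j) *\<^sub>R outer (X \<omega>) \<partial>\<Omega>)"

lemma has_all_moments_quad_series: "has_all_moments \<Omega> (\<lambda>\<omega>. (quad_series P (X \<omega>) ^ m) $ j)"
  by (rule poly_grad_quad_series_power[OF transpose_P, of m]) (rule has_all_moments_poly_grad(1))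

lemma integrable_scaleR_outer:
  assumes "has_all_moments \<Omega> c"
  shows "integrable \<Omega> (\<lambda>\<omega>. c \<omega> *\<^sub>R outer (X \<omega>))"
  by (rule integrable_matrix, unfold inner_scaleR_outer_vector)
    (intro has_all_moments_integrable has_all_moments_mult has_all_moments_linear assms)

lemma integrable_quad_form:
  "integrable \<Omega> (\<lambda>\<omega>. (quad_series P (X \<omega>) ^ m) $ j * ((y \<bullet> X \<omega>) * (z \<bullet> X \<omega>)))"
  by (intro has_all_moments_integrable has_all_moments_mult has_all_moments_quad_series has_all_moments_linear)

lemma integrable_quad_moment: "integrable \<Omega> (\<lambda>\<omega>. ((quad_series P (X \<omega>) ^ m) $ j) *\<^sub>R outer (X \<omega>))"
  by (intro integrable_scaleR_outer has_all_moments_quad_series)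

lemma quad_moment_form:
  "y \<bullet> (quad_moment m j *v z) = expectation (\<lambda>\<omega>. (quad_series P (X \<omega>) ^ m) $ j * ((y \<bullet> X \<omega>) * (z \<bullet> X \<omega>)))"
  unfolding quad_moment_def inner_integral_matrix_vector[OF integrable_quad_moment] inner_scaleR_outer_vector ..

text \<open>The trace of P^(a + 1), in the form in which \<open>stein_quadratic\<close> delivers
  it.\<close>

definition mpow_trace :: "nat \<Rightarrow> real" where
  "mpow_trace a = (\<Sum>b\<in>Basis. b \<bullet> (mpow P (Suc a) *v b))"

text \<open>Stein's identity for the factor \<open>X \<bullet> P^a X\<close>. Its action on the remaining factors is the derivation
  \<open>P^(a + 1) x \<bullet> \<nabla>\<close>; summed against \<open>s^a\<close>, it maps the series \<open>q(s)\<close> of the quadratic forms to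
  \<open>2 q'(s)\<close>, which produces the term with \<open>2 (1 + j)\<close>.\<close>

lemma quad_moment_Suc:
  "quad_moment (Suc m) j =
    (\<Sum>a\<le>j. mpow_trace a *\<^sub>R quad_moment m (j - a)
      + (mpow P (Suc a) ** quad_moment m (j - a) + quad_moment m (j - a) ** mpow P (Suc a)))
    + (2 * (1 + real j)) *\<^sub>R quad_moment m (Suc j)"
proof (rule matrix_eq_form)
  fix y z
  obtain H where H: "\<And>j. poly_grad (\<lambda>x. (quad_series P x ^ m) $ j) (H j)"
    "\<And>j a x. (mpow P (Suc a) *v x) \<bullet> H j x
      = 2 * ((of_nat m * quad_series P x ^ (m - 1)) * Abs_fps (\<lambda>b. quad_series P x $ Suc (a + b))) $ j"
    using that by (rule poly_grad_quad_series_power[OF transpose_P, of m])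
  let ?h = "\<lambda>j x. (quad_series P x ^ m) $ j"
  let ?f = "\<lambda>j x. ?h j x * ((y \<bullet> x) * (z \<bullet> x))"
  let ?F = "\<lambda>j x. ?h j x *\<^sub>R ((y \<bullet> x) *\<^sub>R z + (z \<bullet> x) *\<^sub>R y) + ((y \<bullet> x) * (z \<bullet> x)) *\<^sub>R H j x"
  have F: "poly_grad (?f j) (?F j)" for j
    by (intro poly_grad.mult poly_grad.linear H)
  have P': "(mpow P k *v x) \<bullet> v = (mpow P k *v v) \<bullet> x" for k x v
    using inner_mpow_shift[OF transpose_P, of k x 0 v] by (simp add: inner_commute)
  have iH: "integrable \<Omega> (\<lambda>\<omega>. ((y \<bullet> X \<omega>) * (z \<bullet> X \<omega>)) * ((mpow P (Suc a) *v X \<omega>) \<bullet> H i (X \<omega>)))" for a i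
  proof -
    have "has_all_moments \<Omega> (\<lambda>\<omega>. (mpow P (Suc a) *v X \<omega>) \<bullet> H i (X \<omega>))"
      unfolding H(2) fps_of_nat[symmetric] fps_mult_nth[of _ "Abs_fps f" for f] fps_mult_left_const_nth fps_nth_Abs_fps
      using has_all_moments_quad_series[of 1]
      by (intro has_all_moments_cmult has_all_moments_sum has_all_moments_mult has_all_moments_quad_series) simp
    then show ?thesis
      by (intro has_all_moments_integrable has_all_moments_mult has_all_moments_linear)
  qed
  \<comment> \<open>Stein's identity for a single a: differentiating y \<bullet> x and z \<bullet> x
    produces the left and right products with P^(a + 1), while the derivative of the series
    coefficient is kept until the sum over a is taken.\<close>
  have one: "expectation (\<lambda>\<omega>. quad_series P (X \<omega>) $ a * ?f i (X \<omega>))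
      = y \<bullet> ((mpow_trace a *\<^sub>R quad_moment m i
          + (mpow P (Suc a) ** quad_moment m i + quad_moment m i ** mpow P (Suc a))) *v z)
        + expectation (\<lambda>\<omega>. ((y \<bullet> X \<omega>) * (z \<bullet> X \<omega>)) * ((mpow P (Suc a) *v X \<omega>) \<bullet> H i (X \<omega>)))" for a i
  proof -
    have "expectation (\<lambda>\<omega>. quad_series P (X \<omega>) $ a * ?f i (X \<omega>))
      = mpow_trace a * expectation (\<lambda>\<omega>. ?f i (X \<omega>))
        + expectation (\<lambda>\<omega>. (mpow P (Suc a) *v X \<omega>) \<bullet> ?F i (X \<omega>))"
      using stein_quadratic[OF F[of i] transpose_mpow[OF transpose_P, of a]]
      by (simp add: quad_series_def mpow_trace_def matrix_vector_mul_assoc)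
    also have "(\<lambda>\<omega>. (mpow P (Suc a) *v X \<omega>) \<bullet> ?F i (X \<omega>)) = (\<lambda>\<omega>.
        (?h i (X \<omega>) * ((y \<bullet> X \<omega>) * ((mpow P (Suc a) *v z) \<bullet> X \<omega>))
          + ?h i (X \<omega>) * (((mpow P (Suc a) *v y) \<bullet> X \<omega>) * (z \<bullet> X \<omega>)))
        + ((y \<bullet> X \<omega>) * (z \<bullet> X \<omega>)) * ((mpow P (Suc a) *v X \<omega>) \<bullet> H i (X \<omega>)))"
      by (rule ext) (simp only: inner_add_right inner_scaleR_right distrib_left P'[of "Suc a" _ z] P'[of "Suc a" _ y] mult_ac add_ac)
    also have "expectation \<dots> = y \<bullet> (quad_moment m i *v (mpow P (Suc a) *v z))
        + (mpow P (Suc a) *v y) \<bullet> (quad_moment m i *v z)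
        + expectation (\<lambda>\<omega>. ((y \<bullet> X \<omega>) * (z \<bullet> X \<omega>)) * ((mpow P (Suc a) *v X \<omega>) \<bullet> H i (X \<omega>)))"
      unfolding quad_moment_form
      by (simp only: Bochner_Integration.integral_add Bochner_Integration.integrable_add integrable_quad_form iH)
    also have "(mpow P (Suc a) *v y) \<bullet> (quad_moment m i *v z) = y \<bullet> (mpow P (Suc a) *v (quad_moment m i *v z))"
      using P'[of "Suc a" y "quad_moment m i *v z"] by (simp only: inner_commute[of y])
    finally show ?thesis
      by (simp add: quad_moment_form[symmetric] matrix_vector_mult_add_rdistrib inner_add_right
          scaleR_matrix_vector_assoc[symmetric] matrix_vector_mul_assoc matrix_mul_assoc del: mpow.simps)
  qed
  have iq: "integrable \<Omega> (\<lambda>\<omega>. quad_series P (X \<omega>) $ a * ?f i (X \<omega>))" for a i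
    using has_all_moments_quad_series[of 1 a]
    by (intro has_all_moments_integrable has_all_moments_mult has_all_moments_quad_series has_all_moments_linear) simp
  have "(\<Sum>a\<le>j. (mpow P (Suc a) *v x) \<bullet> H (j - a) x) = 2 * (1 + real j) * (quad_series P x ^ m) $ Suc j" for x
  proof -
    let ?q = "quad_series P x"
    have "(\<Sum>a\<le>j. (mpow P (Suc a) *v x) \<bullet> H (j - a) x) = 2 * ((of_nat m * ?q ^ (m - 1)) * fps_deriv ?q) $ j"
      by (simp only: H(2) sum_distrib_left[symmetric] sum_shifted_series)
    also have "(of_nat m * ?q ^ (m - 1)) * fps_deriv ?q = fps_deriv (?q ^ m)"
      by (simp add: fps_deriv_power mult_ac fps_of_nat)
    finally show ?thesis by simp
  qed
  then have H_sum: "(\<Sum>a\<le>j. ((y \<bullet> x) * (z \<bullet> x)) * ((mpow P (Suc a) *v x) \<bullet> H (j - a) x))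
      = (2 * (1 + real j)) * ?f (Suc j) x" for x
    by (simp add: sum_distrib_left[symmetric] mult_ac)
  have "y \<bullet> (quad_moment (Suc m) j *v z) = expectation (\<lambda>\<omega>. \<Sum>a\<le>j. quad_series P (X \<omega>) $ a * ?f (j - a) (X \<omega>))"
    unfolding quad_moment_form power_Suc fps_mult_nth atMost_atLeast0 sum_distrib_right
    by (simp only: mult.assoc)
  also have "\<dots> = (\<Sum>a\<le>j. expectation (\<lambda>\<omega>. quad_series P (X \<omega>) $ a * ?f (j - a) (X \<omega>)))"
    by (intro Bochner_Integration.integral_sum iq)
  also have "\<dots> = y \<bullet> ((\<Sum>a\<le>j. mpow_trace a *\<^sub>R quad_moment m (j - a)
      + (mpow P (Suc a) ** quad_moment m (j - a) + quad_moment m (j - a) ** mpow P (Suc a))) *v z)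
      + (\<Sum>a\<le>j. expectation (\<lambda>\<omega>. ((y \<bullet> X \<omega>) * (z \<bullet> X \<omega>)) * ((mpow P (Suc a) *v X \<omega>) \<bullet> H (j - a) (X \<omega>))))"
    unfolding linear_sum[OF bounded_linear.linear[OF bounded_linear_matrix_form[of y z]]] sum.distrib[symmetric] one ..
  also have "(\<Sum>a\<le>j. expectation (\<lambda>\<omega>. ((y \<bullet> X \<omega>) * (z \<bullet> X \<omega>)) * ((mpow P (Suc a) *v X \<omega>) \<bullet> H (j - a) (X \<omega>))))
      = expectation (\<lambda>\<omega>. \<Sum>a\<le>j. ((y \<bullet> X \<omega>) * (z \<bullet> X \<omega>)) * ((mpow P (Suc a) *v X \<omega>) \<bullet> H (j - a) (X \<omega>)))"
    by (intro Bochner_Integration.integral_sum[symmetric] iH)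
  also have "\<dots> = y \<bullet> (((2 * (1 + real j)) *\<^sub>R quad_moment m (Suc j)) *v z)"
    unfolding H_sum by (simp add: quad_moment_form scaleR_matrix_vector_assoc[symmetric])
  finally show "y \<bullet> (quad_moment (Suc m) j *v z) = y \<bullet> (((\<Sum>a\<le>j. mpow_trace a *\<^sub>R quad_moment m (j - a)
      + (mpow P (Suc a) ** quad_moment m (j - a) + quad_moment m (j - a) ** mpow P (Suc a)))
    + (2 * (1 + real j)) *\<^sub>R quad_moment m (Suc j)) *v z)"
    by (simp add: matrix_vector_mult_add_rdistrib inner_add_right)
qed

lemma quad_moment_0: "quad_moment 0 j = (if j = 0 then P else 0)"
proof (rule matrix_eq_form)
  fix y z show "y \<bullet> (quad_moment 0 j *v z) = y \<bullet> ((if j = 0 then P else 0) *v z)"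
    unfolding quad_moment_form by (simp add: fps_one_nth expectation_linear_mult_linear)
qed

end

section \<open>Nonnegative combinations of matrix powers\<close>

text \<open>All matrices compared below are combinations of powers of \<open>A\<close> with nonnegative coefficients, so they
  commute and are positive semidefinite without any recourse to eigenvectors.\<close>

inductive mpow_cone :: "real^'n^'n \<Rightarrow> real^'n^'n \<Rightarrow> bool" for A where
  zero: "mpow_cone A 0"
| scaleR_mpow: "0 \<le> c \<Longrightarrow> mpow_cone A (c *\<^sub>R mpow A k)"
| add: "mpow_cone A S \<Longrightarrow> mpow_cone A T \<Longrightarrow> mpow_cone A (S + T)"

lemma mpow_cone_mpow: "mpow_cone A (mpow A k)"
  using mpow_cone.scaleR_mpow[of 1 A k] by simp

lemma mpow_cone_scaleR: "mpow_cone A S \<Longrightarrow> 0 \<le> c \<Longrightarrow> mpow_cone A (c *\<^sub>R S)"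
proof (induction rule: mpow_cone.induct)
  case (scaleR_mpow d k)
  then show ?case using mpow_cone.scaleR_mpow[of "c * d" A k] by simp
qed (auto simp: scaleR_add_right intro: mpow_cone.intros)

lemma mpow_cone_sum: "(\<And>i. i \<in> I \<Longrightarrow> mpow_cone A (S i)) \<Longrightarrow> mpow_cone A (\<Sum>i\<in>I. S i)"
  by (induction I rule: infinite_finite_induct) (auto intro: mpow_cone.intros)

lemma mpow_cone_mult_mpow: "mpow_cone A S \<Longrightarrow> mpow_cone A (S ** mpow A k)"
proof (induction rule: mpow_cone.induct)
  case (scaleR_mpow c j)
  then show ?case
    using mpow_cone.scaleR_mpow[of c A "j + k"] by (simp add: matrix_mult.scaleR_left mpow_add)
qed (auto simp: matrix_mult.add_left matrix_mult.zero_left intro: mpow_cone.intros)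

lemma mpow_cone_commute: "mpow_cone A S \<Longrightarrow> mpow A k ** S = S ** mpow A k"
proof (induction rule: mpow_cone.induct)
  case (scaleR_mpow c j)
  then show ?case
    by (simp add: matrix_mult.scaleR_left matrix_mult.scaleR_right mpow_add[symmetric] add.commute)
qed (simp_all add: matrix_mult.add_left matrix_mult.add_right matrix_mult.zero_left matrix_mult.zero_right)

lemma transpose_add: "transpose (A + B) = transpose A + transpose (B :: real^'n^'m)"
  by (simp add: transpose_def vec_eq_iff)

lemma symmetric_mat_add: "symmetric_mat S \<Longrightarrow> symmetric_mat T \<Longrightarrow> symmetric_mat (S + T)"
  by (simp add: symmetric_mat_def transpose_add)

lemma symmetric_mat_scaleR: "symmetric_mat S \<Longrightarrow> symmetric_mat (c *\<^sub>R S)"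
  by (simp add: symmetric_mat_def transpose_scalar)

lemma symmetric_mat_0: "symmetric_mat 0"
  by (simp add: symmetric_mat_def transpose_def vec_eq_iff)

lemma symmetric_mat_sum: "(\<And>i. i \<in> I \<Longrightarrow> symmetric_mat (S i)) \<Longrightarrow> symmetric_mat (\<Sum>i\<in>I. S i)"
  by (induction I rule: infinite_finite_induct) (auto intro: symmetric_mat_add symmetric_mat_0)

text \<open>Symmetry moves half of the factors across the inner product, leaving the squared norm of
  A^j x or the form of A at A^j x.\<close>

lemma pos_def_inner_mpow_nonneg:
  assumes "pos_def A"
  shows "0 \<le> x \<bullet> (mpow A k *v x)"
proof -
  have A: "transpose A = A" and nn: "0 \<le> y \<bullet> (A *v y)" for y
    using assms by (cases "y = 0"; auto simp: pos_def_def symmetric_mat_def less_imp_le)+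
  show ?thesis
  proof (cases "even k")
    case True
    then obtain j where "k = j + j" by (auto elim!: evenE simp: mult_2)
    then show ?thesis using inner_mpow_shift[OF A, of j x j x] by (metis inner_ge_zero)
  next
    case False
    then obtain j where "k = j + Suc j" by (auto elim!: oddE simp: mult_2)
    then show ?thesis
      using inner_mpow_shift[OF A, of j x "Suc j" x] nn[of "mpow A j *v x"]
      by (simp add: matrix_vector_mul_assoc)
  qed
qed

lemma pos_semidef_mpow_cone:
  assumes "mpow_cone A S" and A: "pos_def A"
  shows "pos_semidef S"
  using assms(1)
proof (induction rule: mpow_cone.induct)
  case zero
  then show ?case by (simp add: pos_semidef_def symmetric_mat_0)
next
  case (scaleR_mpow c k)
  then show ?case
    using A pos_def_inner_mpow_nonneg[OF A, of _ k]
    by (simp add: pos_semidef_def pos_def_def symmetric_mat_def transpose_scalar transpose_mpow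
        scaleR_matrix_vector_assoc[symmetric])
next
  case (add S T)
  then show ?case
    by (simp add: pos_semidef_def symmetric_mat_add matrix_vector_mult_add_rdistrib inner_add_right)
qed

text \<open>The order also demands that both sides be symmetric; for T this follows from S and the
  difference.\<close>

lemma loewner_leI_mpow_cone:
  assumes "symmetric_mat S" and "mpow_cone A (T - S)" and "pos_def A"
  shows "S \<preceq>\<^sub>L T"
proof -
  have TS: "pos_semidef (T - S)" using assms pos_semidef_mpow_cone by blast
  then have "symmetric_mat (T - S + S)"
    using assms(1) by (intro symmetric_mat_add) (simp_all add: pos_semidef_def)
  then show ?thesis using assms(1) TS by (simp add: loewner_le_def)
qed

section \<open>Words in the outer product and the covariance\<close>

lemma sum_triangle_swap:
  fixes f :: "nat \<Rightarrow> nat \<Rightarrow> 'v::comm_monoid_add"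
  shows "(\<Sum>a\<le>n. \<Sum>b\<le>n - a. f a b) = (\<Sum>b\<le>n. \<Sum>a\<le>n - b. f a b)"
  unfolding sum.Sigma[OF finite_atMost ballI[OF finite_atMost]]
  by (rule sum.reindex_bij_witness[where i = prod.swap and j = prod.swap]) auto

text \<open>\<open>natpermute n m\<close> is the index set of W(m, n). Splitting off the first
  letter prepares induction on the number of letters.\<close>

lemma sum_natpermute_Suc:
  "(\<Sum>v\<in>natpermute n (Suc m). f v) = (\<Sum>a\<le>n. \<Sum>w\<in>natpermute (n - a) m. f (a # w))"
proof -
  have "(\<Sum>a\<le>n. \<Sum>w\<in>natpermute (n - a) m. f (a # w)) = (\<Sum>(a, w)\<in>(SIGMA a:{..n}. natpermute (n - a) m). f (a # w))"
    by (rule sum.Sigma) (auto simp: natpermute_finite)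
  also have "\<dots> = (\<Sum>v\<in>natpermute n (Suc m). f v)"
    by (rule sum.reindex_bij_witness[where i = "\<lambda>v. (hd v, tl v)" and j = "\<lambda>(a, w). a # w"])
      (auto simp: natpermute_def length_Suc_conv)
  finally show ?thesis ..
qed

text \<open>The grouping behind both inequalities: each odd index goes with its even successor, and
  index 0 stands alone.\<close>

lemma sum_lessThan_odd_pairs:
  fixes f :: "nat \<Rightarrow> 'v::comm_monoid_add"
  shows "(\<Sum>k<2 * n + 1. f k) = f 0 + (\<Sum>k\<in>{1..n}. f (2 * k - 1) + f (2 * k))"
  by (induction n) (simp_all add: ac_simps)

lemma has_bochner_integral_matrix_mult:
  assumes "has_bochner_integral M f (I :: real^'n^'n)"
  shows "has_bochner_integral M (\<lambda>x. A ** f x) (A ** I)" and "has_bochner_integral M (\<lambda>x. f x ** A) (I ** A)"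
  using has_bochner_integral_bounded_linear[OF matrix_mult.bounded_linear_right assms]
    has_bochner_integral_bounded_linear[OF matrix_mult.bounded_linear_left assms] by auto

text \<open>With \<open>\<phi> d = 1 + d\<close> this is the integrand of \<open>W(m + 1, n)\<close>: every word with \<open>m + 1\<close> letters collapses
  to a product of \<open>m\<close> quadratic forms times \<open>outer x ** mpow A d\<close>, where \<open>d\<close> is its last exponent.\<close>

definition outer_sum :: "real^'n^'n \<Rightarrow> real^'n \<Rightarrow> (nat \<Rightarrow> real) \<Rightarrow> nat \<Rightarrow> nat \<Rightarrow> real^'n^'n" where
  "outer_sum A x \<phi> m n = (\<Sum>d\<le>n. (\<phi> d * (quad_series A x ^ m) $ (n - d)) *\<^sub>R (outer x ** mpow A d))"

text \<open>A new first letter with exponent a collapses against the following outer product to the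
  factor q(a); the sum over a is a Cauchy product.\<close>

lemma outer_mult_outer_sum:
  "(\<Sum>a\<le>n. outer x ** (mpow A a ** outer_sum A x \<phi> m (n - a))) = outer_sum A x \<phi> (Suc m) n"
proof -
  have "(\<Sum>a\<le>n. outer x ** (mpow A a ** outer_sum A x \<phi> m (n - a)))
      = (\<Sum>a\<le>n. \<Sum>d\<le>n - a. (\<phi> d * (quad_series A x $ a * (quad_series A x ^ m) $ (n - d - a))) *\<^sub>R (outer x ** mpow A d))"
    by (simp add: outer_sum_def matrix_mult.sum_right matrix_mult.scaleR_right outer_sandwich
        quad_series_def mult_ac add.commute)
  also have "\<dots> = outer_sum A x \<phi> (Suc m) n"
    by (subst sum_triangle_swap)
      (simp add: outer_sum_def fps_mult_nth atMost_atLeast0 sum_distrib_left scaleR_sum_left)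
  finally show ?thesis .
qed

text \<open>The weight depends on the last exponent only, which prepending a letter does not
  change.\<close>

lemma sum_natpermute_mprod:
  "(\<Sum>v\<in>natpermute n (Suc m). \<phi> (last v) *\<^sub>R mprod (map (\<lambda>k. outer x ** mpow A k) v)) = outer_sum A x \<phi> m n"
proof (induction m arbitrary: n)
  case 0
  \<comment> \<open>The series to the power 0 is 1, so only d = n survives.\<close>
  have "outer_sum A x \<phi> 0 n = (\<Sum>d\<le>n. if d = n then \<phi> n *\<^sub>R (outer x ** mpow A n) else 0)"
    unfolding outer_sum_def by (rule sum.cong) auto
  then show ?case by (simp add: mprod_def)
next
  case (Suc m)
  have "last (a # w) = last w" if "w \<in> natpermute (n - a) (Suc m)" for a w
    using that by (auto simp: natpermute_def)
  then have "(\<Sum>v\<in>natpermute n (Suc (Suc m)). \<phi> (last v) *\<^sub>R mprod (map (\<lambda>k. outer x ** mpow A k) v))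
    = (\<Sum>a\<le>n. outer x ** (mpow A a ** (\<Sum>w\<in>natpermute (n - a) (Suc m). \<phi> (last w) *\<^sub>R mprod (map (\<lambda>k. outer x ** mpow A k) w))))"
    unfolding sum_natpermute_Suc
    by (simp add: mprod_def matrix_mult.sum_right matrix_mult.scaleR_right matrix_mul_assoc)
  also have "\<dots> = outer_sum A x \<phi> (Suc m) n"
    by (simp only: Suc.IH outer_mult_outer_sum)
  finally show ?case .
qed

text \<open>The collapse of a single word, from which its integrability is derived.\<close>

lemma mprod_outer:
  "v \<noteq> [] \<Longrightarrow> mprod (map (\<lambda>k. outer x ** mpow A k) v)
    = prod_list (map (\<lambda>a. quad_series A x $ a) (butlast v)) *\<^sub>R (outer x ** mpow A (last v))"
proof (induction v)
  case (Cons a v)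
  show ?case
  proof (cases "v = []")
    case False
    have "mprod (map (\<lambda>k. outer x ** mpow A k) (a # v)) = outer x ** (mpow A a ** mprod (map (\<lambda>k. outer x ** mpow A k) v))"
      by (simp add: mprod_def matrix_mul_assoc)
    also have "\<dots> = prod_list (map (\<lambda>a. quad_series A x $ a) (butlast (a # v))) *\<^sub>R (outer x ** mpow A (last (a # v)))"
      using False Cons.IH by (simp add: matrix_mult.scaleR_right outer_sandwich quad_series_def mult_ac)
    finally show ?thesis .
  qed (simp add: mprod_def)
qed simp

text \<open>The constant coefficient of the series is x \<bullet> x for every A, so its m-th power
  contributes the scalar (x \<bullet> x)^m.\<close>

lemma mpow_outer: "mpow (outer x) (Suc m) = ((quad_series A x ^ m) $ 0) *\<^sub>R outer x"
proof (induction m)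
  case (Suc m)
  have "outer x ** outer x = (x \<bullet> x) *\<^sub>R outer x"
    using outer_sandwich[of x "mat 1" "mat 1"] by simp
  with Suc show ?case
    by (simp add: matrix_mult.scaleR_right quad_series_def mult_ac)
qed simp

text \<open>Noncommutative binomial expansion: k counts the factors A, and a those among them that
  precede the first outer product. What follows is a word with n - k letters. The product without
  outer products is the separate first term.\<close>

lemma mpow_outer_diff:
  fixes A :: "real^'n^'n"
  shows "mpow (outer x - A) n = (- 1) ^ n *\<^sub>R mpow A n
    + (\<Sum>k<n. (- 1) ^ k *\<^sub>R (\<Sum>a\<le>k. mpow A a ** outer_sum A x (\<lambda>_. 1) (n - k - 1) (k - a)))"
proof (induction n)
  case (Suc n)
  let ?T = "outer_sum A x (\<lambda>_. 1)"
  \<comment> \<open>\<open>E m k\<close> collects all products of m + 1 outer products and k factors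
    A. \<open>OE\<close> prepends an outer product, and \<open>ES\<close> splits by the first
    factor.\<close>
  define E where "E m k = (\<Sum>a\<le>k. mpow A a ** ?T m (k - a))" for m k
  have OE: "outer x ** E m k = ?T (Suc m) k" for m k
    unfolding E_def matrix_mult.sum_right by (rule outer_mult_outer_sum)
  have ES: "E m (Suc k) = ?T m (Suc k) + A ** E m k" for m k
    unfolding E_def sum.atMost_Suc_shift by (simp add: matrix_mult.sum_right matrix_mul_assoc)
  have E0: "E m 0 = ?T m 0" for m
    by (simp add: E_def)
  have T0: "outer x ** mpow A k = ?T 0 k" for k
  proof -
    have "?T 0 k = (\<Sum>d\<le>k. if d = k then outer x ** mpow A k else 0)"
      unfolding outer_sum_def by (rule sum.cong) auto
    then show ?thesis by simp
  qed
  have "mpow (outer x - A) (Suc n) = (outer x - A) ** ((- 1) ^ n *\<^sub>R mpow A n + (\<Sum>k<n. (- 1) ^ k *\<^sub>R E (n - k - 1) k))"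
    using Suc.IH by (simp add: E_def)
  also have "\<dots> = (- 1) ^ n *\<^sub>R ?T 0 n + (\<Sum>k<n. (- 1) ^ k *\<^sub>R ?T (n - k) k)
      - ((- 1) ^ n *\<^sub>R mpow A (Suc n) + (\<Sum>k<n. (- 1) ^ k *\<^sub>R (A ** E (n - k - 1) k)))"
  proof -
    have "(\<Sum>k<n. (- 1) ^ k *\<^sub>R (outer x ** E (n - k - 1) k)) = (\<Sum>k<n. (- 1) ^ k *\<^sub>R ?T (n - k) k)"
      by (rule sum.cong) (simp_all add: OE Suc_diff_Suc)
    then show ?thesis
      unfolding matrix_mult.diff_left
      by (simp add: matrix_mult.add_right matrix_mult.sum_right matrix_mult.scaleR_right T0)
  qed
  also have "\<dots> = (- 1) ^ Suc n *\<^sub>R mpow A (Suc n) + (\<Sum>k<Suc n. (- 1) ^ k *\<^sub>R E (Suc n - k - 1) k)"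
  proof -
    have "(\<Sum>k<Suc n. (- 1) ^ k *\<^sub>R E (Suc n - k - 1) k)
        = E n 0 + (\<Sum>k<n. (- 1) ^ Suc k *\<^sub>R E (n - Suc k) (Suc k))"
      by (subst sum.lessThan_Suc_shift) simp
    also have "\<dots> = (\<Sum>k<Suc n. (- 1) ^ k *\<^sub>R ?T (n - k) k) + (\<Sum>k<n. (- 1) ^ Suc k *\<^sub>R (A ** E (n - Suc k) k))"
      by (subst sum.lessThan_Suc_shift) (simp add: ES E0 scaleR_add_right sum.distrib sum_negf sum_subtractf)
    finally show ?thesis
      by (simp add: sum_negf)
  qed
  finally show ?case by (simp only: E_def)
qed simp

section \<open>Expectations of words and comparison of the sums W\<close>

context centered_gaussian_space
begin

lemma mpow_trace_nonneg: "0 \<le> mpow_trace a"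
  unfolding mpow_trace_def by (intro sum_nonneg pos_def_inner_mpow_nonneg pos_def)

text \<open>The coefficients of the recursion are nonnegative, and commutation turns left products
  into right ones. The recursion lowers m but also uses index \<open>Suc j\<close>, so j must be
  arbitrary in the induction.\<close>

lemma mpow_cone_quad_moment: "mpow_cone P (quad_moment m j)"
proof (induction m arbitrary: j)
  case 0
  show ?case
    using mpow_cone_mpow[of P 1] by (simp add: quad_moment_0 mpow_cone.zero)
next
  case (Suc m)
  show ?case
    unfolding quad_moment_Suc mpow_cone_commute[OF Suc.IH]
    by (intro mpow_cone.add mpow_cone_sum mpow_cone_scaleR mpow_cone_mult_mpow Suc.IH mpow_trace_nonneg) simp
qed

lemma integrable_word: "v \<noteq> [] \<Longrightarrow> integrable \<Omega> (\<lambda>\<omega>. mprod (map (\<lambda>k. outer (X \<omega>) ** mpow P k) v))"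
proof -
  assume "v \<noteq> []"
  have "has_all_moments \<Omega> (\<lambda>\<omega>. prod_list (map (\<lambda>a. quad_series P (X \<omega>) $ a) w))" for w
  proof (induction w)
    case (Cons a w)
    then show ?case
      using has_all_moments_mult[OF has_all_moments_quad_series[of 1 a]] by simp
  qed (simp add: has_all_moments_const)
  then have "integrable \<Omega> (\<lambda>\<omega>. prod_list (map (\<lambda>a. quad_series P (X \<omega>) $ a) w) *\<^sub>R outer (X \<omega>))" for w
    by (rule integrable_scaleR_outer)
  then have "integrable \<Omega> (\<lambda>\<omega>. (prod_list (map (\<lambda>a. quad_series P (X \<omega>) $ a) (butlast v)) *\<^sub>R outer (X \<omega>)) ** mpow P (last v))"
    by (rule integrable_bounded_linear[OF matrix_mult.bounded_linear_left])
  then show ?thesis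
    using \<open>v \<noteq> []\<close> by (simp add: mprod_outer matrix_mult.scaleR_left)
qed

lemma has_bochner_integral_outer_sum:
  "has_bochner_integral \<Omega> (\<lambda>\<omega>. outer_sum P (X \<omega>) \<phi> m n) (\<Sum>d\<le>n. \<phi> d *\<^sub>R (quad_moment m (n - d) ** mpow P d))"
proof -
  have "has_bochner_integral \<Omega> (\<lambda>\<omega>. ((quad_series P (X \<omega>) ^ m) $ j) *\<^sub>R outer (X \<omega>)) (quad_moment m j)" for j
    using integrable_quad_moment by (simp add: has_bochner_integral_iff quad_moment_def)
  then have "has_bochner_integral \<Omega> (\<lambda>\<omega>. \<Sum>d\<le>n. \<phi> d *\<^sub>R ((((quad_series P (X \<omega>) ^ m) $ (n - d)) *\<^sub>R outer (X \<omega>)) ** mpow P d))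
      (\<Sum>d\<le>n. \<phi> d *\<^sub>R (quad_moment m (n - d) ** mpow P d))"
    by (intro has_bochner_integral_sum has_bochner_integral_scaleR_right has_bochner_integral_matrix_mult)
  then show ?thesis
    by (simp add: outer_sum_def matrix_mult.scaleR_left)
qed

lemma W_sum_eq: "W_sum \<Omega> X P (Suc m) n = (\<Sum>d\<le>n. (1 + real d) *\<^sub>R (quad_moment m (n - d) ** mpow P d))"
proof -
  have L: "{v. length v = Suc m \<and> sum_list v = n} = natpermute n (Suc m)"
    by (auto simp: natpermute_def)
  have "W_sum \<Omega> X P (Suc m) n
      = (\<integral>\<omega>. (\<Sum>v\<in>natpermute n (Suc m). (1 + real (last v)) *\<^sub>R mprod (map (\<lambda>k. outer (X \<omega>) ** mpow P k) v)) \<partial>\<Omega>)"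
    unfolding W_sum_def word_moment_def L
    by (subst Bochner_Integration.integral_sum)
      (auto simp: natpermute_def intro!: integrable_word integrable_scaleR_right sum.cong)
  also have "\<dots> = (\<integral>\<omega>. outer_sum P (X \<omega>) (\<lambda>d. 1 + real d) m n \<partial>\<Omega>)"
    by (simp only: sum_natpermute_mprod[of "\<lambda>d. 1 + real d"])
  finally show ?thesis
    using has_bochner_integral_integral_eq[OF has_bochner_integral_outer_sum] by simp
qed

lemma mpow_cone_W_sum: "mpow_cone P (W_sum \<Omega> X P (Suc m) n)"
  unfolding W_sum_eq
  by (intro mpow_cone_sum mpow_cone_scaleR mpow_cone_mult_mpow mpow_cone_quad_moment) simp

text \<open>B(0, j) vanishes for j > 0. This value is needed for the last, unpaired term of the even
  expansion.\<close>

lemma W_sum_1: "W_sum \<Omega> X P 1 n = (1 + real n) *\<^sub>R mpow P (Suc n)"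
proof -
  have "W_sum \<Omega> X P 1 n = (\<Sum>d\<le>n. if d = n then (1 + real n) *\<^sub>R mpow P (Suc n) else 0)"
    unfolding One_nat_def W_sum_eq by (rule sum.cong) (auto simp: quad_moment_0 matrix_mult.zero_left)
  then show ?thesis by simp
qed

text \<open>Identifies the k = 0 term of the expansion.\<close>

lemma integral_mpow_outer: "(\<integral>\<omega>. mpow (outer (X \<omega>)) (Suc m) \<partial>\<Omega>) = W_sum \<Omega> X P (Suc m) 0"
  by (simp only: mpow_outer[where A = P]) (simp add: W_sum_eq quad_moment_def)

text \<open>Under the expectation the leading P^a commutes with the moment and merges with the
  trailing P^d. Each total exponent c = a + d occurs 1 + c times, which is the weight in W.\<close>

lemma integral_mpow_outer_diff:
  "(\<integral>\<omega>. mpow (outer (X \<omega>) - P) n \<partial>\<Omega>)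
    = (- 1) ^ n *\<^sub>R mpow P n + (\<Sum>k<n. (- 1) ^ k *\<^sub>R W_sum \<Omega> X P (n - k) k)"
proof -
  have W: "(\<Sum>a\<le>k. mpow P a ** (\<Sum>d\<le>k - a. 1 *\<^sub>R (quad_moment m (k - a - d) ** mpow P d))) = W_sum \<Omega> X P (Suc m) k" for m k
  proof -
    have "mpow P a ** (quad_moment m j ** mpow P d) = quad_moment m j ** mpow P (a + d)" for a d j
      by (simp add: matrix_mul_assoc mpow_cone_commute[OF mpow_cone_quad_moment] mpow_add)
    then show ?thesis
      using sum_triangle_add[of "\<lambda>c. quad_moment m (k - c) ** mpow P c" k]
      by (simp add: matrix_mult.sum_right W_sum_eq)
  qed
  have "has_bochner_integral \<Omega> (\<lambda>\<omega>. mpow (outer (X \<omega>) - P) n)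
     ((- 1) ^ n *\<^sub>R mpow P n + (\<Sum>k<n. (- 1) ^ k *\<^sub>R (\<Sum>a\<le>k. mpow P a **
        (\<Sum>d\<le>k - a. 1 *\<^sub>R (quad_moment (n - k - 1) (k - a - d) ** mpow P d)))))"
    unfolding mpow_outer_diff
    by (intro has_bochner_integral_add has_bochner_integral_sum has_bochner_integral_scaleR_right
        has_bochner_integral_matrix_mult has_bochner_integral_outer_sum)
      (simp add: has_bochner_integral_iff prob_space)
  then show ?thesis
    unfolding W by (simp add: has_bochner_integral_integral_eq Suc_diff_Suc cong: sum.cong_simp)
qed

text \<open>Two parts of the recursion are kept: the derivative term and, from a = j, the two
  products with P^(j + 1). The latter are needed for the moment B(m, 0), which the derivative terms
  never reach.\<close>

lemma mpow_cone_quad_moment_Suc_diff: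
  "mpow_cone P (quad_moment (Suc m) j - ((2 * (1 + real j)) *\<^sub>R quad_moment m (Suc j) + 2 *\<^sub>R (quad_moment m 0 ** mpow P (Suc j))))"
proof -
  let ?f = "\<lambda>a. mpow_trace a *\<^sub>R quad_moment m (j - a) + 2 *\<^sub>R (quad_moment m (j - a) ** mpow P (Suc a))"
  have f: "mpow_cone P (?f a)" for a
    by (intro mpow_cone.add mpow_cone_scaleR mpow_cone_mult_mpow mpow_cone_quad_moment mpow_trace_nonneg) simp
  have "quad_moment (Suc m) j = (\<Sum>a\<le>j. ?f a) + (2 * (1 + real j)) *\<^sub>R quad_moment m (Suc j)"
    unfolding quad_moment_Suc mpow_cone_commute[OF mpow_cone_quad_moment] by (simp add: scaleR_2)
  also have "(\<Sum>a\<le>j. ?f a) = (\<Sum>a<j. ?f a) + ?f j"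
    by (simp add: lessThan_Suc_atMost[symmetric])
  finally have "quad_moment (Suc m) j - ((2 * (1 + real j)) *\<^sub>R quad_moment m (Suc j) + 2 *\<^sub>R (quad_moment m 0 ** mpow P (Suc j)))
      = (\<Sum>a<j. ?f a) + mpow_trace j *\<^sub>R quad_moment m 0"
    by simp
  then show ?thesis
    by (auto intro!: mpow_cone.add mpow_cone_sum f mpow_cone_scaleR mpow_cone_quad_moment mpow_trace_nonneg simp del: mpow.simps)
qed

text \<open>The factor \<open>4/3\<close> in place of \<open>2\<close> would suffice for the coefficient \<open>1/4\<close> of the theorem.\<close>

lemma mpow_cone_W_sum_diff:
  assumes "1 \<le> p"
  shows "mpow_cone P (W_sum \<Omega> X P (Suc (Suc m)) p - 2 *\<^sub>R W_sum \<Omega> X P (Suc m) (Suc p))"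
proof -
  let ?B = "\<lambda>d. quad_moment m (Suc p - d) ** mpow P d"
  define D where "D j = quad_moment (Suc m) j - ((2 * (1 + real j)) *\<^sub>R quad_moment m (Suc j) + 2 *\<^sub>R (quad_moment m 0 ** mpow P (Suc j)))" for j
  have summand: "(1 + real d) *\<^sub>R (quad_moment (Suc m) (p - d) ** mpow P d)
      = (1 + real d) *\<^sub>R (D (p - d) ** mpow P d) + ((1 + real d) * (2 * (1 + real (p - d)))) *\<^sub>R ?B d
        + (2 * (1 + real d)) *\<^sub>R ?B (Suc p)" if "d \<le> p" for d
  proof -
    have "(quad_moment m 0 ** mpow P (Suc (p - d))) ** mpow P d = ?B (Suc p)"
      using that by (simp add: matrix_mul_assoc[symmetric] mpow_add[symmetric])
    moreover have "quad_moment (Suc m) (p - d) = D (p - d) + ((2 * (1 + real (p - d))) *\<^sub>R quad_moment m (Suc p - d)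
        + 2 *\<^sub>R (quad_moment m 0 ** mpow P (Suc (p - d))))"
      using that by (simp add: D_def Suc_diff_le)
    ultimately show ?thesis
      by (simp only: matrix_mult.add_left matrix_mult.scaleR_left) (simp add: scaleR_add_right mult_ac)
  qed
  \<comment> \<open>The total coefficient with which the second kept part contributes B(m, 0) P^(p +
    1).\<close>
  have gauss: "(\<Sum>d\<le>p. 2 * (1 + real d)) = (real p + 1) * (real p + 2)"
    by (induction p) (simp_all add: algebra_simps)
  have "W_sum \<Omega> X P (Suc (Suc m)) p = (\<Sum>d\<le>p. (1 + real d) *\<^sub>R (D (p - d) ** mpow P d))
      + (\<Sum>d\<le>p. ((1 + real d) * (2 * (1 + real (p - d)))) *\<^sub>R ?B d) + ((real p + 1) * (real p + 2)) *\<^sub>R ?B (Suc p)"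
    unfolding W_sum_eq gauss[symmetric] scaleR_sum_left sum.distrib[symmetric]
    by (rule sum.cong) (simp_all add: summand)
  moreover have "2 *\<^sub>R W_sum \<Omega> X P (Suc m) (Suc p)
      = (\<Sum>d\<le>p. ((1 + real d) * 2) *\<^sub>R ?B d) + (2 * (real p + 2)) *\<^sub>R ?B (Suc p)"
    unfolding W_sum_eq sum.atMost_Suc scaleR_add_right scaleR_sum_right by (simp add: algebra_simps)
  \<comment> \<open>Since 1 + (p - d) \<ge> 1, the middle coefficients stay nonnegative. The last
    one is (p + 1) (p + 2) - 2 (p + 2) = (p - 1) (p + 2), which is where p \<ge> 1 enters.\<close>
  ultimately have "W_sum \<Omega> X P (Suc (Suc m)) p - 2 *\<^sub>R W_sum \<Omega> X P (Suc m) (Suc p)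
      = (\<Sum>d\<le>p. (1 + real d) *\<^sub>R (D (p - d) ** mpow P d))
      + (\<Sum>d\<le>p. ((1 + real d) * (2 * real (p - d))) *\<^sub>R ?B d) + ((real p - 1) * (real p + 2)) *\<^sub>R ?B (Suc p)"
    by (simp add: algebra_simps sum.distrib[symmetric] sum_subtractf[symmetric] del: of_nat_diff)
      (simp flip: scaleR_add_left)
  moreover have "mpow_cone P (D j)" for j
    unfolding D_def by (rule mpow_cone_quad_moment_Suc_diff)
  ultimately show ?thesis
    using assms
    by (auto intro!: mpow_cone.add mpow_cone_sum mpow_cone_scaleR mpow_cone_mult_mpow mpow_cone_quad_moment
        simp del: mpow.simps)
qed

lemma symmetric_mat_mpow_cone: "mpow_cone P S \<Longrightarrow> symmetric_mat S"
  using pos_semidef_mpow_cone[OF _ pos_def] by (auto simp: pos_semidef_def)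

lemma symmetric_mat_integral: "symmetric_mat (\<integral>\<omega>. mpow (outer (X \<omega>) - P) n \<partial>\<Omega>)"
  unfolding integral_mpow_outer_diff
proof (intro symmetric_mat_add symmetric_mat_scaleR symmetric_mat_sum)
  show "symmetric_mat (mpow P n)" by (rule symmetric_mat_mpow_cone[OF mpow_cone_mpow])
  show "symmetric_mat (W_sum \<Omega> X P (n - k) k)" if "k \<in> {..<n}" for k
    using that symmetric_mat_mpow_cone[OF mpow_cone_W_sum[of "n - k - 1" k]] by (simp add: Suc_diff_Suc)
qed

text \<open>For an odd term U and its successor V, U - V - U/4 = (U - 2 V)/2 + U/4, and both
  summands lie in the cone. The bound on N keeps at least one letter in every word.\<close>

lemma mpow_cone_pairs:
  assumes "2 * n < N"
  shows "mpow_cone P (- (\<Sum>k\<in>{1..n}. (- 1) ^ (2 * k - 1) *\<^sub>R W_sum \<Omega> X P (N - (2 * k - 1)) (2 * k - 1)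
        + (- 1) ^ (2 * k) *\<^sub>R W_sum \<Omega> X P (N - 2 * k) (2 * k))
      - (1 / 4) *\<^sub>R (\<Sum>k\<in>{1..n}. W_sum \<Omega> X P (N - (2 * k - 1)) (2 * k - 1)))"
  unfolding scaleR_sum_right sum_negf[symmetric] sum_subtractf[symmetric]
proof (rule mpow_cone_sum)
  fix k assume k: "k \<in> {1..n}"
  define m where "m = N - 2 * k - 1"
  have m: "N - 2 * k = Suc m" "N - (2 * k - 1) = Suc (Suc m)" and p: "Suc (2 * k - 1) = 2 * k"
    using assms k by (auto simp: m_def)
  let ?U = "W_sum \<Omega> X P (Suc (Suc m)) (2 * k - 1)" and ?V = "W_sum \<Omega> X P (Suc m) (2 * k)"
  have odd: "(- 1 :: real) ^ (2 * k - 1) = - 1"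
    using k by (intro neg_one_odd_power) auto
  have "mpow_cone P ((1 / 2) *\<^sub>R (?U - 2 *\<^sub>R ?V) + (1 / 4) *\<^sub>R ?U)"
    using mpow_cone_W_sum_diff[of "2 * k - 1" m] k
    by (intro mpow_cone.add mpow_cone_scaleR mpow_cone_W_sum) (auto simp: p)
  also have "(1 / 2) *\<^sub>R (?U - 2 *\<^sub>R ?V) + (1 / 4) *\<^sub>R ?U = - (- ?U + ?V) - (1 / 4) *\<^sub>R ?U"
    by (simp add: algebra_simps flip: scaleR_add_left)
  finally show "mpow_cone P (- ((- 1) ^ (2 * k - 1) *\<^sub>R W_sum \<Omega> X P (N - (2 * k - 1)) (2 * k - 1)
        + (- 1) ^ (2 * k) *\<^sub>R W_sum \<Omega> X P (N - 2 * k) (2 * k))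
      - (1 / 4) *\<^sub>R W_sum \<Omega> X P (N - (2 * k - 1)) (2 * k - 1))"
    unfolding m odd by simp
qed

text \<open>The 2 n + 1 terms consist of the moment of the power at k = 0 and n complete
  pairs.\<close>

lemma loewner_le_odd:
  "(\<integral>\<omega>. mpow (outer (X \<omega>) - P) (2 * n + 1) \<partial>\<Omega>)
    \<preceq>\<^sub>L (\<integral>\<omega>. mpow (outer (X \<omega>)) (2 * n + 1) \<partial>\<Omega>) - mpow P (2 * n + 1)
       - (1 / 4) *\<^sub>R (\<Sum>k\<in>{1..n}. W_sum \<Omega> X P (2 * (n + 1 - k)) (2 * k - 1))"
proof (rule loewner_leI_mpow_cone[OF symmetric_mat_integral _ pos_def])
  have W: "(\<Sum>k\<in>{1..n}. W_sum \<Omega> X P (2 * (n + 1 - k)) (2 * k - 1))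
      = (\<Sum>k\<in>{1..n}. W_sum \<Omega> X P (2 * n + 1 - (2 * k - 1)) (2 * k - 1))"
    by (rule sum.cong[OF refl]) (rule arg_cong[where f = "\<lambda>i. W_sum \<Omega> X P i _"], auto)
  define S where "S = (\<Sum>k\<in>{1..n}. (- 1) ^ (2 * k - 1) *\<^sub>R W_sum \<Omega> X P (2 * n + 1 - (2 * k - 1)) (2 * k - 1)
    + (- 1) ^ (2 * k) *\<^sub>R W_sum \<Omega> X P (2 * n + 1 - 2 * k) (2 * k))"
  have E: "(\<integral>\<omega>. mpow (outer (X \<omega>)) (2 * n + 1) \<partial>\<Omega>) = W_sum \<Omega> X P (2 * n + 1) 0"
    using integral_mpow_outer[of "2 * n"] by (simp only: Suc_eq_plus1)
  have I: "(\<integral>\<omega>. mpow (outer (X \<omega>) - P) (2 * n + 1) \<partial>\<Omega>) = W_sum \<Omega> X P (2 * n + 1) 0 + S - mpow P (2 * n + 1)"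
    unfolding integral_mpow_outer_diff sum_lessThan_odd_pairs S_def[symmetric] by (simp del: mpow.simps)
  have "mpow_cone P (- S - (1 / 4) *\<^sub>R (\<Sum>k\<in>{1..n}. W_sum \<Omega> X P (2 * (n + 1 - k)) (2 * k - 1)))"
    unfolding W S_def by (rule mpow_cone_pairs) simp
  moreover have "A - B - Q - (A + S - B) = - S - Q" for A B Q :: "real^'r^'r"
    by simp
  ultimately show "mpow_cone P ((\<integral>\<omega>. mpow (outer (X \<omega>)) (2 * n + 1) \<partial>\<Omega>) - mpow P (2 * n + 1)
       - (1 / 4) *\<^sub>R (\<Sum>k\<in>{1..n}. W_sum \<Omega> X P (2 * (n + 1 - k)) (2 * k - 1))
       - (\<integral>\<omega>. mpow (outer (X \<omega>) - P) (2 * n + 1) \<partial>\<Omega>))"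
    unfolding E I by (simp only:)
qed

text \<open>Besides k = 0 and n - 1 pairs, the odd index k = 2 n - 1 is left over. Its term -2 n
  P^(2 n) and the leading P^(2 n) add up to -(2 n - 1) P^(2 n).\<close>

lemma loewner_le_even:
  "(\<integral>\<omega>. mpow (outer (X \<omega>) - P) (2 * n) \<partial>\<Omega>)
    \<preceq>\<^sub>L (\<integral>\<omega>. mpow (outer (X \<omega>)) (2 * n) \<partial>\<Omega>) - (2 * real n - 1) *\<^sub>R mpow P (2 * n)
       - (1 / 4) *\<^sub>R (\<Sum>k\<in>{1..<n}. W_sum \<Omega> X P (2 * (n - k) + 1) (2 * k - 1))"
proof (rule loewner_leI_mpow_cone[OF symmetric_mat_integral _ pos_def])
  show "mpow_cone P ((\<integral>\<omega>. mpow (outer (X \<omega>)) (2 * n) \<partial>\<Omega>) - (2 * real n - 1) *\<^sub>R mpow P (2 * n)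
       - (1 / 4) *\<^sub>R (\<Sum>k\<in>{1..<n}. W_sum \<Omega> X P (2 * (n - k) + 1) (2 * k - 1))
       - (\<integral>\<omega>. mpow (outer (X \<omega>) - P) (2 * n) \<partial>\<Omega>))"
  proof (cases n)
    case 0
    \<comment> \<open>Here 2 n - 1 is the real number -1, and the two sides differ by the identity
      matrix.\<close>
    then show ?thesis using mpow_cone_mpow[of P 0] by (simp add: prob_space)
  next
    case (Suc p)
    have W: "(\<Sum>k\<in>{1..<n}. W_sum \<Omega> X P (2 * (n - k) + 1) (2 * k - 1))
        = (\<Sum>k\<in>{1..p}. W_sum \<Omega> X P (2 * n - (2 * k - 1)) (2 * k - 1))"
      unfolding Suc atLeastLessThanSuc_atLeastAtMost
      by (rule sum.cong[OF refl]) (rule arg_cong[where f = "\<lambda>i. W_sum \<Omega> X P i _"], auto)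
    define S where "S = (\<Sum>k\<in>{1..p}. (- 1) ^ (2 * k - 1) *\<^sub>R W_sum \<Omega> X P (2 * n - (2 * k - 1)) (2 * k - 1)
      + (- 1) ^ (2 * k) *\<^sub>R W_sum \<Omega> X P (2 * n - 2 * k) (2 * k))"
    have E: "(\<integral>\<omega>. mpow (outer (X \<omega>)) (2 * n) \<partial>\<Omega>) = W_sum \<Omega> X P (2 * n) 0"
      using integral_mpow_outer[of "2 * p + 1"] by (simp add: Suc)
    have n: "2 * n = Suc (2 * p + 1)" by (simp add: Suc)
    have "(\<Sum>k<2 * n. (- 1) ^ k *\<^sub>R W_sum \<Omega> X P (2 * n - k) k)
        = (\<Sum>k<2 * p + 1. (- 1) ^ k *\<^sub>R W_sum \<Omega> X P (2 * n - k) k) - W_sum \<Omega> X P 1 (2 * p + 1)"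
      unfolding n by simp
    also have "W_sum \<Omega> X P 1 (2 * p + 1) = (2 * real n) *\<^sub>R mpow P (2 * n)"
      unfolding W_sum_1 n[symmetric] by (simp add: Suc)
    finally have I: "(\<integral>\<omega>. mpow (outer (X \<omega>) - P) (2 * n) \<partial>\<Omega>)
        = W_sum \<Omega> X P (2 * n) 0 + S - (2 * real n - 1) *\<^sub>R mpow P (2 * n)"
      unfolding integral_mpow_outer_diff sum_lessThan_odd_pairs S_def[symmetric]
      by (simp add: algebra_simps del: mpow.simps)
    have "mpow_cone P (- S - (1 / 4) *\<^sub>R (\<Sum>k\<in>{1..<n}. W_sum \<Omega> X P (2 * (n - k) + 1) (2 * k - 1)))"
      unfolding W S_def by (rule mpow_cone_pairs) (simp add: Suc)
    moreover have "A - B - Q - (A + S - B) = - S - Q" for A B Q :: "real^'r^'r"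
      by simp
    ultimately show ?thesis
      unfolding E I by (simp only:)
  qed
qed

end

theorem theorem1p2:
  fixes \<Omega> :: "'a measure" and X :: "'a \<Rightarrow> real^'r" and P :: "real^'r^'r"
  assumes "prob_space \<Omega>"
    and "centered_gaussian \<Omega> X P"
    and "pos_def P"
  shows "(\<forall>n. (\<integral>\<omega>. mpow (outer (X \<omega>) - P) n \<partial>\<Omega>)
            = (- 1) ^ n *\<^sub>R mpow P n + (\<Sum>k\<in>{0..<n}. (- 1) ^ k *\<^sub>R W_sum \<Omega> X P (n - k) k))
       \<and> (\<forall>n. (\<integral>\<omega>. mpow (outer (X \<omega>) - P) (2 * n) \<partial>\<Omega>)
            \<preceq>\<^sub>L (\<integral>\<omega>. mpow (outer (X \<omega>)) (2 * n) \<partial>\<Omega>) - (2 * real n - 1) *\<^sub>R mpow P (2 * n)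
               - (1 / 4) *\<^sub>R (\<Sum>k\<in>{1..<n}. W_sum \<Omega> X P (2 * (n - k) + 1) (2 * k - 1)))
       \<and> (\<forall>n. (\<integral>\<omega>. mpow (outer (X \<omega>) - P) (2 * n + 1) \<partial>\<Omega>)
            \<preceq>\<^sub>L (\<integral>\<omega>. mpow (outer (X \<omega>)) (2 * n + 1) \<partial>\<Omega>) - mpow P (2 * n + 1)
               - (1 / 4) *\<^sub>R (\<Sum>k\<in>{1..n}. W_sum \<Omega> X P (2 * (n + 1 - k)) (2 * k - 1)))"
proof -
  interpret centered_gaussian_space \<Omega> X P
    using assms by (simp add: centered_gaussian_space_def centered_gaussian_space_axioms_def)
  show ?thesis
    using loewner_le_even loewner_le_odd integral_mpow_outer_diff[unfolded lessThan_atLeast0]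
    by (intro conjI allI)
qed

end
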